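(* Let $n \ge 2$ and $2 \le k \le n$ be integers, let $0 = n_0 < n_1 < \cdots < n_{k-1} < n_k = n$ be integers, and put $r_j = n_j - n_{j-1}$ for $j = 1, \ldots, k$. Let $s_1, \ldots, s_k$ be real numbers with $0 < s_i < r_i$ for each $i$, and let $a < b$ be real numbers. Let $X_1, \ldots, X_k$ be independent random variables, independent of the weights $(V_1,\ldots,V_k)$, such that $X_i$ has the $\widetilde{beta}(s_i,\, r_i - s_i)$ distribution over $[a,b]$ for each $i = 1, \ldots, k$. Then the randomly weighted average $$S_{n:n_1,\ldots,n_{k-1}} = \sum_{j=1}^{k} V_j X_j$$ has the $\widetilde{beta}\left(\sum_{i=1}^{k} s_i,\ \sum_{i=1}^{k} r_i - \sum_{i=1}^{k} s_i\right)$ distribution over $[a,b]$.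
   Context: Random weights: let $U_{(1)} < U_{(2)} < \cdots < U_{(n-1)}$ be the order statistics of a random sample of size $n-1$ from the uniform distribution on $(0,1)$, with the conventions $U_{(0)} = 0$ and $U_{(n)} = 1$. For integers $0 = n_0 < n_1 < \cdots < n_{k-1} < n_k = n$ set $V_j = U_{(n_j)} - U_{(n_{j-1})}$, $j = 1, \ldots, k$ (so $V_1 + \cdots + V_k = 1$, and $(V_1,\ldots,V_k)$ has the Dirichlet distribution with parameters $(r_1, \ldots, r_k)$, where $r_j = n_j - n_{j-1}$ and $\sum_j r_j = n$). Beta distribution over $[a,b]$: for real $a<b$ and $p, q > 0$, $\widetilde{beta}(p,q)$ denotes the probability distribution with density $$f_{p,q}(x) = \frac{1}{B(p,q)\,(b-a)^{p+q-1}} (x-a)^{p-1}(b-x)^{q-1} \quad \text{for } a < x < b,$$ and $f_{p,q}(x)=0$ otherwise, where $B(p,q) = \Gamma(p)\Gamma(q)/\Gamma(p+q)$. The same interval $[a,b]$ is used for all the beta distributions in the statement. *)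

theory Defs
  imports "HOL-Probability.Probability"
begin

(* The sample is y 1, ..., y (n - 1); the (i - 1) reflects that list positions start at 0.
   Only indices i \<le> n are meaningful. *)
definition order_stat :: "nat \<Rightarrow> (nat \<Rightarrow> real) \<Rightarrow> nat \<Rightarrow> real" where
  "order_stat n y i =
     (if i = 0 then 0 else if i = n then 1 else sort (map y [1..<n]) ! (i - 1))"

definition beta_density :: "real \<Rightarrow> real \<Rightarrow> real \<Rightarrow> real \<Rightarrow> real \<Rightarrow> real" where
  "beta_density a b p q x =
     (if a < x \<and> x < b
      then 1 / (Beta p q * (b - a) powr (p + q - 1)) * (x - a) powr (p - 1) * (b - x) powr (q - 1)
      else 0)"

end

theory Submission
  imports Defs
begin

unbundle no vec_syntax and fps_syntax

text \<open>The proof is by the method of moments, after rescaling to \<open>[a,b] = [0,1]\<close>. Let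
  \<open>h m x\<close> be the coefficient of \<open>t ^ m\<close> in the product of the \<open>(1 - x j t) powr (- r j)\<close>. Integrating
  out the order statistics gives, for fixed \<open>x\<close>, that the \<open>m\<close>-th moment of \<open>\<Sum>j. V j * x j\<close> is
  \<open>m! / pochhammer n m * h m x\<close> (a Hermite--Genocchi formula). The beta moments
  \<open>pochhammer s m / pochhammer r m\<close> of the \<open>X j\<close> turn each factor \<open>(1 - x j t) powr (- r j)\<close> into
  \<open>(1 - t) powr (- s j)\<close> on averaging, so the product becomes \<open>(1 - t) powr (- (\<Sum>j. s j))\<close>, and the
  moments of the weighted average are those of the claimed beta distribution.\<close>

section \<open>Moments and beta distributions\<close>

text \<open>All variables are bounded, which is why moments suffice. After rescaling they are also
  almost surely nonnegative, so moments are taken as nonnegative integrals and the induction and the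
  Fubini steps raise no integrability questions. Sorting is awkward to integrate against directly.
  The cube is therefore split according to which sample point is the largest, ties being null; with
  that maximum fixed at \<open>v\<close>, the other points form a smaller sample. The generating
  function comes from weighting each of the \<open>n\<close> single spacings separately: a spacing
  of weight \<open>z\<close> contributes a geometric series with coefficients \<open>z ^ q\<close>,
  and equal weights on the \<open>r j\<close> spacings of a block give the power \<open>r j\<close>
  of that series. Averaging acts on each factor separately because a coefficient of the product is a
  finite sum of products of functions of single independent variables. The factor for
  \<open>j\<close> simplifies because the two beta parameters of \<open>X j\<close> add up to
  \<open>r j\<close>, so that the denominator of its moment cancels
  \<open>pochhammer (r j) q\<close>.\<close>

lemma moments_determine_distribution:
  fixes M N :: "real measure" and C :: real
  assumes M: "real_distribution M" and N: "real_distribution N"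
    and bM: "AE x in M. \<bar>x\<bar> \<le> C" and bN: "AE x in N. \<bar>x\<bar> \<le> C"
    and eq: "\<And>m. (\<integral>x. x ^ m \<partial>M) = (\<integral>x. x ^ m \<partial>N)"
  shows "M = N"
proof (rule Levy_uniqueness[OF M N], rule ext)
  fix t :: real
  interpret M: real_distribution M by (rule M)
  interpret N: real_distribution N by (rule N)
  have integrable_power: "integrable L (\<lambda>x. \<bar>x\<bar> ^ m)" "integrable L (\<lambda>x. x ^ m)"
    and abs_moment_le: "(\<integral>x. \<bar>x\<bar> ^ m \<partial>L) \<le> C ^ m"
    if L: "real_distribution L" and bL: "AE x in L. \<bar>x\<bar> \<le> C" for L m
  proof -
    interpret L: real_distribution L by (rule L)
    have le: "AE x in L. \<bar>x\<bar> ^ m \<le> C ^ m"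
      using bL by eventually_elim (simp add: power_mono)
    show 1: "integrable L (\<lambda>x. \<bar>x\<bar> ^ m)"
      using le by (intro L.integrable_const_bound[of _ "C ^ m"]) auto
    show "integrable L (\<lambda>x. x ^ m)"
      using le by (intro L.integrable_const_bound[of _ "C ^ m"]) (auto simp: power_abs)
    show "(\<integral>x. \<bar>x\<bar> ^ m \<partial>L) \<le> C ^ m"
      using 1 le by (rule L.integral_le_const)
  qed
  \<comment> \<open>Taylor expansion of the characteristic function. The polynomial depends only on
    the moments, so it is the same for \<open>M\<close> and \<open>N\<close>; the bound is twice a
    term of the exponential series and tends to 0.\<close>
  have approx: "cmod (char L t - (\<Sum>k\<le>n. ((\<i> * t)^k / fact k) * (\<integral>x. x ^ k \<partial>L)))
      \<le> 2 * ((\<bar>t\<bar> * C) ^ n / fact n)"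
    if L: "real_distribution L" and bL: "AE x in L. \<bar>x\<bar> \<le> C" for L n
  proof -
    have "cmod (char L t - (\<Sum>k\<le>n. ((\<i> * t)^k / fact k) * (\<integral>x. x ^ k \<partial>L)))
        \<le> (2 * \<bar>t\<bar>^n / fact n) * (\<integral>x. \<bar>x\<bar> ^ n \<partial>L)"
      by (intro real_distribution.char_approx1 integrable_power L bL)
    also have "\<dots> \<le> (2 * \<bar>t\<bar>^n / fact n) * C ^ n"
      by (intro mult_left_mono abs_moment_le L bL) auto
    finally show ?thesis by (simp add: power_mult_distrib)
  qed
  have diff_le: "cmod (char M t - char N t) \<le> 4 * ((\<bar>t\<bar> * C) ^ n / fact n)" for n
  proof -
    let ?p = "\<Sum>k\<le>n. ((\<i> * t)^k / fact k) * (\<integral>x. x ^ k \<partial>M)"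
    have "cmod (char M t - char N t) \<le> cmod (char M t - ?p) + cmod (char N t - ?p)"
      using norm_triangle_ineq4[of "char M t - ?p" "char N t - ?p"] by simp
    also have "\<dots> \<le> 2 * ((\<bar>t\<bar> * C) ^ n / fact n) + 2 * ((\<bar>t\<bar> * C) ^ n / fact n)"
      using approx[OF M bM, of n] approx[OF N bN, of n] by (intro add_mono) (simp_all add: eq)
    finally show ?thesis by simp
  qed
  have "(\<lambda>n. 4 * ((\<bar>t\<bar> * C) ^ n / fact n)) \<longlonglongrightarrow> 4 * 0"
    using summable_LIMSEQ_zero[OF summable_exp[of "\<bar>t\<bar> * C"]]
    by (intro tendsto_mult tendsto_const) (simp add: divide_inverse mult.commute)
  then have "cmod (char M t - char N t) \<le> 4 * 0"
    by (rule LIMSEQ_le_const) (use diff_le in auto)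
  then show "char M t = char N t" by simp
qed

section \<open>Moments of beta distributions\<close>

lemma nn_integral_Beta:
  fixes p q :: real
  assumes "0 < p" "0 < q"
  shows "(\<integral>\<^sup>+x. ennreal (indicator {0<..<1} x * (x powr (p - 1) * (1 - x) powr (q - 1))) \<partial>lborel)
           = ennreal (Beta p q)"
proof -
  have "(\<integral>\<^sup>+x. ennreal (indicator {0<..<1} x * (x powr (p - 1) * (1 - x) powr (q - 1))) \<partial>lborel)
      = (\<integral>\<^sup>+x. ennreal (indicator {0..1} x * (x powr (p - 1) * (1 - x) powr (q - 1))) \<partial>lborel)"
    \<comment> \<open>The integrands agree even at 0 and 1, because \<open>0 powr c = 0\<close> for
      every \<open>c\<close>, negative ones included.\<close>
    by (intro nn_integral_cong) (auto simp: indicator_def)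
  also have "\<dots> = ennreal (Beta p q)"
    using nn_integral_has_integral_lebesgue[OF _ has_integral_Beta_real[OF assms]]
    by (simp add: ennreal_mult' ennreal_indicator)
  finally show ?thesis .
qed

lemma Beta_pos_real: "0 < p \<Longrightarrow> 0 < q \<Longrightarrow> 0 < Beta p (q::real)"
  by (simp add: Beta_def Gamma_real_pos)

lemma Beta_add_nat_left:
  fixes p q :: real
  assumes "0 < p" "0 < q"
  shows "Beta (p + real m) q = Beta p q * (pochhammer p m / pochhammer (p + q) m)"
proof (induction m)
  case (Suc m)
  have "p + real m \<notin> \<int>\<^sub>\<le>\<^sub>0" using assms by (auto elim!: nonpos_Ints_cases)
  from Beta_plus1_left[OF this, of q]
  have "(p + real m + q) * Beta (p + real (Suc m)) q = (p + real m) * Beta (p + real m) q"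
    by (simp add: add_ac)
  then have "Beta (p + real (Suc m)) q = (p + real m) / (p + q + real m) * Beta (p + real m) q"
    using assms by (simp add: field_simps)
  then show ?case unfolding Suc.IH by (simp add: pochhammer_Suc field_simps)
qed simp

text \<open>Multiplication by \<open>x ^ m\<close> shifts \<open>p\<close> to \<open>p + m\<close>,
  so the moment is a quotient of two Beta values. The case \<open>m = 0\<close> says that the
  density has total mass 1.\<close>

lemma beta_density_moment:
  fixes p q :: real
  assumes "0 < p" "0 < q"
  shows "(\<integral>\<^sup>+x. ennreal (beta_density 0 1 p q x) * ennreal (x ^ m) \<partial>lborel)
           = ennreal (pochhammer p m / pochhammer (p + q) m)"
proof -
  have "(\<integral>\<^sup>+x. ennreal (beta_density 0 1 p q x) * ennreal (x ^ m) \<partial>lborel)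
      = (\<integral>\<^sup>+x. ennreal (1 / Beta p q) *
          ennreal (indicator {0<..<1} x * (x powr (p + real m - 1) * (1 - x) powr (q - 1))) \<partial>lborel)"
  proof (rule nn_integral_cong)
    fix x :: real
    show "ennreal (beta_density 0 1 p q x) * ennreal (x ^ m) = ennreal (1 / Beta p q) *
        ennreal (indicator {0<..<1} x * (x powr (p + real m - 1) * (1 - x) powr (q - 1)))"
    proof (cases "0 < x \<and> x < 1")
      case True
      then have "x powr (p + real m - 1) = x powr (p - 1) * x ^ m"
        by (simp add: powr_realpow[symmetric] powr_add[symmetric] algebra_simps)
      with True show ?thesis
        using Beta_pos_real[OF assms]
        by (simp add: beta_density_def ennreal_mult'[symmetric] mult_ac)
    qed (auto simp: beta_density_def)
  qed
  also have "\<dots> = ennreal (1 / Beta p q) * ennreal (Beta (p + real m) q)"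
    using assms by (subst nn_integral_cmult) (auto simp: nn_integral_Beta)
  also have "\<dots> = ennreal (pochhammer p m / pochhammer (p + q) m)"
    using Beta_pos_real[OF assms] assms
    by (simp add: Beta_add_nat_left ennreal_mult'[symmetric])
  finally show ?thesis .
qed

text \<open>The substitution \<open>v = t * x\<close> leads to a Beta integral with integer
  parameters. In the induction on the sample size, \<open>v\<close> is the sample maximum:
  \<open>v ^ i\<close> comes from the points below it and \<open>(t - v) ^ j\<close> from the last
  spacing.\<close>

lemma nn_integral_power_mult_power:
  assumes "0 \<le> t"
  shows "(\<integral>\<^sup>+v. ennreal (indicator {0<..<t} v * (v ^ i * (t - v) ^ j)) \<partial>lborel)
           = ennreal (fact i * fact j / fact (i + j + 1) * t ^ (i + j + 1))"
proof (cases "t = 0")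
  case False
  with assms have t: "0 < t" by simp
  have "(\<integral>\<^sup>+v. ennreal (indicator {0<..<t} v * (v ^ i * (t - v) ^ j)) \<partial>lborel)
      = ennreal t * (\<integral>\<^sup>+x. ennreal (indicator {0<..<t} (t * x) * ((t * x) ^ i * (t - t * x) ^ j)) \<partial>lborel)"
    using t by (subst nn_integral_real_affine[where c=t and t=0]) auto
  also have "\<dots> = ennreal t * (\<integral>\<^sup>+x. ennreal (t ^ (i + j)) *
      ennreal (indicator {0<..<1} x * (x powr (real (i+1) - 1) * (1 - x) powr (real (j+1) - 1))) \<partial>lborel)"
  proof (intro arg_cong2[of _ _ _ _ "(*)"] nn_integral_cong refl)
    fix x
    have "(t - t * x) ^ j = t ^ j * (1 - x) ^ j"
      by (simp add: power_mult_distrib[symmetric] algebra_simps)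
    then show "ennreal (indicator {0<..<t} (t * x) * ((t * x) ^ i * (t - t * x) ^ j)) = ennreal (t ^ (i + j)) *
      ennreal (indicator {0<..<1} x * (x powr (real (i+1) - 1) * (1 - x) powr (real (j+1) - 1)))"
      using t by (auto simp: indicator_def ennreal_mult'[symmetric] powr_realpow power_mult_distrib
          power_add zero_less_mult_iff mult_ac)
  qed
  also have "\<dots> = ennreal t * (ennreal (t ^ (i + j)) * ennreal (Beta (real (i+1)) (real (j+1))))"
    using nn_integral_Beta[of "real (i+1)" "real (j+1)"] by (subst nn_integral_cmult) simp_all
  also have "Beta (real (i+1)) (real (j+1)) = fact i * fact j / fact (i + j + 1)"
    using Gamma_fact[of i, where 'a=real] Gamma_fact[of j, where 'a=real] Gamma_fact[of "i+j+1", where 'a=real]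
    by (simp add: Beta_def add_ac)
  also have "ennreal t * (ennreal (t ^ (i + j)) * ennreal (fact i * fact j / fact (i + j + 1)))
      = ennreal (fact i * fact j / fact (i + j + 1) * t ^ (i + j + 1))"
    using t by (simp add: ennreal_mult'[symmetric] mult_ac)
  finally show ?thesis .
qed simp

section \<open>Powers of geometric series\<close>

(* The power series of (1 - x t) powr (- c) in t. *)
definition rising_fps :: "real \<Rightarrow> real \<Rightarrow> real fps" where
  "rising_fps c x = Abs_fps (\<lambda>q. pochhammer c q / fact q * x ^ q)"

lemma rising_fps_nth: "rising_fps c x $ q = pochhammer c q / fact q * x ^ q"
  by (simp add: rising_fps_def)

lemma rising_fps_1_nth: "rising_fps 1 x $ q = x ^ q"
  by (simp add: rising_fps_nth pochhammer_fact[symmetric])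

lemma rising_fps_0: "rising_fps 0 x = 1"
  by (rule fps_ext) (auto simp: rising_fps_nth pochhammer_0_left)

text \<open>The exponent law for the powers of \<open>1 - x t\<close>; on coefficients it is the
  Vandermonde convolution of rising factorials.\<close>

lemma rising_fps_add: "rising_fps (c + d) x = rising_fps c x * rising_fps d x"
proof (rule fps_ext)
  fix m
  have "(rising_fps c x * rising_fps d x) $ m
      = (\<Sum>i\<le>m. real (m choose i) * pochhammer c i * pochhammer d (m - i) / fact m * x ^ m)"
    unfolding fps_mult_nth atLeast0AtMost
  proof (rule sum.cong[OF refl])
    fix i assume "i \<in> {..m}"
    then have "x ^ m = x ^ i * x ^ (m - i)" "real (m choose i) = fact m / (fact i * fact (m - i))"
      by (simp_all add: power_add[symmetric] binomial_fact)
    then show "rising_fps c x $ i * rising_fps d x $ (m - i)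
        = real (m choose i) * pochhammer c i * pochhammer d (m - i) / fact m * x ^ m"
      by (simp add: rising_fps_nth)
  qed
  also have "\<dots> = pochhammer (c + d) m / fact m * x ^ m"
    by (simp add: pochhammer_binomial_sum sum_distrib_right sum_divide_distrib)
  finally show "rising_fps (c + d) x $ m = (rising_fps c x * rising_fps d x) $ m"
    by (simp add: rising_fps_nth)
qed

lemma rising_fps_power: "rising_fps c x ^ r = rising_fps (real r * c) x"
  by (induction r) (simp_all add: rising_fps_0 rising_fps_add[symmetric] algebra_simps)

lemma rising_fps_sum: "finite J \<Longrightarrow> rising_fps (\<Sum>j\<in>J. c j) x = (\<Prod>j\<in>J. rising_fps (c j) x)"
  by (induction J rule: finite_induct) (simp_all add: rising_fps_0 rising_fps_add)

lemma rising_fps_nonneg: "0 \<le> c \<Longrightarrow> 0 \<le> x \<Longrightarrow> 0 \<le> rising_fps c x $ q"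
  by (cases "c = 0") (simp_all add: rising_fps_0 rising_fps_nth pochhammer_nonneg)

lemma fps_prod_nth_nonneg:
  fixes F :: "'i \<Rightarrow> real fps"
  assumes "\<And>i q. i \<in> J \<Longrightarrow> 0 \<le> F i $ q"
  shows "0 \<le> (\<Prod>i\<in>J. F i) $ m"
  using assms
  by (induction J arbitrary: m rule: infinite_finite_induct)
     (auto simp: fps_mult_nth intro!: sum_nonneg)

lemma measurable_fps_prod_nth:
  fixes F :: "'i \<Rightarrow> 'a \<Rightarrow> real fps"
  assumes "\<And>i q. i \<in> J \<Longrightarrow> (\<lambda>x. F i x $ q) \<in> borel_measurable M"
  shows "(\<lambda>x. (\<Prod>i\<in>J. F i x) $ m) \<in> borel_measurable M"
  using assms
  by (induction J arbitrary: m rule: infinite_finite_induct)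
     (auto simp: fps_mult_nth)

text \<open>Independent random series can be averaged factor by factor. Splitting off one factor
  turns a coefficient into a Cauchy sum whose terms separate the variables; nonnegativity lets the
  finite sums and products pass through \<open>ennreal\<close>.\<close>

lemma (in product_prob_space) nn_integral_fps_prod:
  fixes F :: "'i \<Rightarrow> 'a \<Rightarrow> real fps" and G :: "'i \<Rightarrow> real fps"
  assumes "finite J"
    and "\<And>i q. i \<in> J \<Longrightarrow> (\<lambda>x. F i x $ q) \<in> borel_measurable (M i)"
    and "\<And>i q x. i \<in> J \<Longrightarrow> 0 \<le> F i x $ q"
    and "\<And>i q. i \<in> J \<Longrightarrow> 0 \<le> G i $ q"
    and "\<And>i q. i \<in> J \<Longrightarrow> (\<integral>\<^sup>+x. ennreal (F i x $ q) \<partial>M i) = ennreal (G i $ q)"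
  shows "(\<integral>\<^sup>+x. ennreal ((\<Prod>i\<in>J. F i (x i)) $ m) \<partial>Pi\<^sub>M J M) = ennreal ((\<Prod>i\<in>J. G i) $ m)"
  using assms
proof (induction J arbitrary: m rule: finite_induct)
  case empty
  interpret Q: prob_space "Pi\<^sub>M {} M" by (rule prob_space_PiM) (rule prob_space)
  show ?case by (cases "m = 0") (simp_all add: Q.emeasure_space_1)
next
  case (insert i I)
  note [measurable] = insert.prems(1)
  have comp: "(\<lambda>x. F j (x j) $ q) \<in> borel_measurable (Pi\<^sub>M K M)"
    if "j \<in> insert i I" "j \<in> K" for j K q
    using measurable_component_singleton[OF that(2), of M] insert.prems(1)[OF that(1), of q]
    by (rule measurable_compose)
  have [measurable]: "(\<lambda>x. (\<Prod>j\<in>J. F j (x j)) $ m) \<in> borel_measurable (Pi\<^sub>M K M)"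
    if "J \<subseteq> insert i I" "J \<subseteq> K" for J K m
    using that by (intro measurable_fps_prod_nth comp) auto
  let ?P = "\<lambda>x. \<Prod>j\<in>I. F j (x j)"
  have [measurable]: "(\<lambda>x. ?P x $ q) \<in> borel_measurable (Pi\<^sub>M I M)" for q
    by (intro measurable_fps_prod_nth comp) auto
  have upd: "(\<Prod>j\<in>insert i I. F j ((x(i := y)) j)) = F i y * ?P x" for x y
    using insert.hyps by (auto intro!: arg_cong2[of _ _ _ _ "(*)"] prod.cong)
  have nonneg: "0 \<le> ?P x $ q" for x q
    using insert.prems(2) by (intro fps_prod_nth_nonneg) auto
  have nonneg_G: "0 \<le> (\<Prod>j\<in>I. G j) $ q" for q
    using insert.prems(3) by (intro fps_prod_nth_nonneg) auto
  have "(\<integral>\<^sup>+x. ennreal ((\<Prod>j\<in>insert i I. F j (x j)) $ m) \<partial>Pi\<^sub>M (insert i I) M)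
      = (\<integral>\<^sup>+x. (\<integral>\<^sup>+y. ennreal ((F i y * ?P x) $ m) \<partial>M i) \<partial>Pi\<^sub>M I M)"
  proof -
    have "(\<lambda>x. ennreal ((\<Prod>j\<in>insert i I. F j (x j)) $ m)) \<in> borel_measurable (Pi\<^sub>M (insert i I) M)"
      by measurable
    from product_nn_integral_insert[OF insert.hyps this] show ?thesis unfolding upd .
  qed
  also have "\<dots> = (\<integral>\<^sup>+x. (\<Sum>q=0..m. ennreal (G i $ q) * ennreal (?P x $ (m - q))) \<partial>Pi\<^sub>M I M)"
  proof (rule nn_integral_cong)
    fix x
    have "(\<integral>\<^sup>+y. ennreal ((F i y * ?P x) $ m) \<partial>M i)
        = (\<integral>\<^sup>+y. (\<Sum>q=0..m. ennreal (F i y $ q) * ennreal (?P x $ (m - q))) \<partial>M i)"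
      using insert.prems(2) nonneg
      by (intro nn_integral_cong)
         (simp add: fps_mult_nth ennreal_mult[symmetric] sum_ennreal)
    also have "\<dots> = (\<Sum>q=0..m. (\<integral>\<^sup>+y. ennreal (F i y $ q) * ennreal (?P x $ (m - q)) \<partial>M i))"
      by (intro nn_integral_sum) auto
    also have "\<dots> = (\<Sum>q=0..m. ennreal (G i $ q) * ennreal (?P x $ (m - q)))"
      by (subst nn_integral_multc) (auto simp: insert.prems(4))
    finally show "(\<integral>\<^sup>+y. ennreal ((F i y * ?P x) $ m) \<partial>M i) = \<dots>" .
  qed
  also have "\<dots> = (\<Sum>q=0..m. (\<integral>\<^sup>+x. ennreal (G i $ q) * ennreal (?P x $ (m - q)) \<partial>Pi\<^sub>M I M))"
    by (intro nn_integral_sum) auto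
  also have "\<dots> = (\<Sum>q=0..m. ennreal (G i $ q) * ennreal ((\<Prod>j\<in>I. G j) $ (m - q)))"
    by (subst nn_integral_cmult) (measurable, auto simp: insert)
  also have "\<dots> = ennreal ((\<Prod>j\<in>insert i I. G j) $ m)"
    using insert.hyps insert.prems(3) nonneg_G
    by (simp add: fps_mult_nth ennreal_mult[symmetric] sum_ennreal)
  finally show ?case .
qed

section \<open>Spacings of uniform order statistics\<close>

abbreviation (input) unit_uniform :: "real measure" where
  "unit_uniform \<equiv> uniform_measure lborel {0<..<1}"

lemma prob_space_unit_uniform: "prob_space unit_uniform"
  by (rule prob_space_uniform_measure) auto

lemma product_prob_space_unit_uniform: "product_prob_space (\<lambda>_. unit_uniform)"
  by (simp add: product_prob_spaceI prob_space_unit_uniform)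

lemma nn_integral_unit_uniform_initial:
  assumes [measurable]: "f \<in> borel_measurable borel" and "t \<le> 1"
  shows "(\<integral>\<^sup>+v. indicator {0<..<t} v * f v \<partial>unit_uniform)
           = (\<integral>\<^sup>+v. indicator {0<..<t} v * f v \<partial>lborel)"
proof -
  have "(\<integral>\<^sup>+v. indicator {0<..<t} v * f v \<partial>unit_uniform)
      = (\<integral>\<^sup>+v. indicator {0<..<t} v * f v * indicator {0<..<1} v \<partial>lborel)"
    by (subst nn_integral_uniform_measure) (auto simp: divide_ennreal_def)
  also have "\<dots> = (\<integral>\<^sup>+v. indicator {0<..<t} v * f v \<partial>lborel)"
    using assms by (intro nn_integral_cong) (auto simp: indicator_def)
  finally show ?thesis .
qed

lemma emeasure_unit_uniform_singleton: "emeasure unit_uniform {x} = 0"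
proof -
  have "emeasure lborel ({0<..<1} \<inter> {x}) \<le> emeasure lborel {x}"
    by (intro emeasure_mono) auto
  then show ?thesis by (simp add: emeasure_uniform_measure)
qed

text \<open>With all coordinates but \<open>u i\<close> fixed, the tie \<open>u i = u j\<close>
  confines \<open>u i\<close> to a single point, which has measure zero; Fubini and a finite union
  over pairs do the rest.\<close>

lemma AE_unit_uniform_inj_on:
  assumes "finite I"
  shows "AE u in Pi\<^sub>M I (\<lambda>_. unit_uniform). inj_on u I"
proof -
  interpret product_prob_space "\<lambda>_. unit_uniform" by (rule product_prob_space_unit_uniform)
  have neq: "AE u in Pi\<^sub>M I (\<lambda>_. unit_uniform). u i \<noteq> u j"
    if "i \<in> I" "j \<in> I" "i \<noteq> j" for i j
  proof -
    define J where "J = I - {i}"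
    have J: "finite J" "i \<notin> J" "j \<in> J" "I = insert i J" using assms that by (auto simp: J_def)
    note [measurable] = measurable_component_singleton[of i I "\<lambda>_. unit_uniform"]
      measurable_component_singleton[of j I "\<lambda>_. unit_uniform"]
    have m: "(\<lambda>u. indicator {0} (u i - u j) :: ennreal) \<in> borel_measurable (Pi\<^sub>M I (\<lambda>_. unit_uniform))"
      using that by measurable
    have "(\<integral>\<^sup>+u. indicator {0} (u i - u j) \<partial>Pi\<^sub>M I (\<lambda>_. unit_uniform))
        = (\<integral>\<^sup>+u. (\<integral>\<^sup>+v. indicator {0} (v - u j) \<partial>unit_uniform) \<partial>Pi\<^sub>M J (\<lambda>_. unit_uniform))"
      using m J that(3) unfolding J(4) by (subst product_nn_integral_insert) auto
    also have "\<dots> = (\<integral>\<^sup>+u. (\<integral>\<^sup>+v. indicator {u j} v \<partial>unit_uniform) \<partial>Pi\<^sub>M J (\<lambda>_. unit_uniform))"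
      by (intro nn_integral_cong) (auto simp: indicator_def)
    also have "\<dots> = 0" by (simp add: emeasure_unit_uniform_singleton)
    finally have "AE u in Pi\<^sub>M I (\<lambda>_. unit_uniform). indicator {0} (u i - u j) = (0::ennreal)"
      using m by (subst (asm) nn_integral_0_iff_AE) auto
    then show ?thesis by eventually_elim (auto simp: indicator_def)
  qed
  have "AE u in Pi\<^sub>M I (\<lambda>_. unit_uniform). \<forall>i\<in>I. \<forall>j\<in>I - {i}. u i \<noteq> u j"
    using assms by (intro AE_finite_allI neq) auto
  then show ?thesis by eventually_elim (auto simp: inj_on_def)
qed

section \<open>Sorted samples over an arbitrary index set\<close>

definition sorted_values :: "'i set \<Rightarrow> ('i \<Rightarrow> real) \<Rightarrow> real list" where
  "sorted_values I u = sorted_list_of_multiset (image_mset u (mset_set I))"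

lemma sorted_sorted_values [simp]: "sorted (sorted_values I u)"
  by (simp add: sorted_values_def)

lemma length_sorted_values [simp]: "length (sorted_values I u) = card I"
  by (metis sorted_values_def mset_sorted_list_of_multiset size_mset size_image_mset size_mset_set)

lemma set_sorted_values [simp]: "finite I \<Longrightarrow> set (sorted_values I u) = u ` I"
  by (simp add: sorted_values_def)

lemma sorted_values_insert_max:
  assumes "finite I" "i \<notin> I" "\<And>j. j \<in> I \<Longrightarrow> u j \<le> v"
  shows "sorted_values (insert i I) (u(i := v)) = sorted_values I u @ [v]"
proof -
  have "image_mset (u(i := v)) (mset_set I) = image_mset u (mset_set I)"
    using assms by (intro image_mset_cong) auto
  then have "sorted_values (insert i I) (u(i := v)) = insort v (sorted_values I u)"
    using assms by (simp add: sorted_values_def)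
  also have "\<dots> = sorted_values I u @ [v]"
    using assms by (intro sorted_insort_is_snoc) auto
  finally show ?thesis .
qed

lemma sorted_nth_le_iff:
  fixes l :: "'a::linorder list"
  shows "sorted l \<Longrightarrow> k < length l \<Longrightarrow> l ! k \<le> c \<longleftrightarrow> k < length (filter (\<lambda>x. x \<le> c) l)"
proof (induction l arbitrary: k)
  case (Cons a l)
  show ?case
  proof (cases "a \<le> c")
    case True
    then show ?thesis using Cons by (cases k) auto
  next
    case False
    then have "filter (\<lambda>x. x \<le> c) (a # l) = []" using Cons.prems by (auto simp: filter_empty_conv)
    moreover have "a \<le> (a # l) ! k" using Cons.prems by (cases k) auto
    ultimately show ?thesis using False by (metis list.size(3) not_less_zero order_trans)
  qed
qed simp

text \<open>This is the route to measurability: an order statistic is at most \<open>c\<close> iff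
  enough sample values are, and their number is a finite sum of indicators. Positions count from 0,
  hence the strict inequality.\<close>

lemma sorted_values_nth_le_iff:
  assumes "k < card I"
  shows "sorted_values I u ! k \<le> c \<longleftrightarrow> real k < (\<Sum>j\<in>I. indicator {..c} (u j))"
proof -
  have fin: "finite I" using assms card_ge_0_finite by force
  have "length (filter (\<lambda>x. x \<le> c) (sorted_values I u))
      = size (filter_mset (\<lambda>x. x \<le> c) (image_mset u (mset_set I)))"
    by (metis sorted_values_def mset_sorted_list_of_multiset mset_filter size_mset)
  also have "\<dots> = card {j \<in> I. u j \<le> c}"
    using fin by (simp add: filter_mset_image_mset)
  also have "real \<dots> = (\<Sum>j\<in>I. indicator {..c} (u j))"
    using fin by (simp add: indicator_def sum.If_cases Int_def)
  finally have "real (length (filter (\<lambda>x. x \<le> c) (sorted_values I u))) = (\<Sum>j\<in>I. indicator {..c} (u j))" .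
  moreover have "k < length (sorted_values I u)" using assms by simp
  ultimately show ?thesis
    by (metis sorted_nth_le_iff[OF sorted_sorted_values] of_nat_less_iff)
qed

lemma measurable_sorted_values_nth:
  assumes "k < card I" and M: "\<And>j. j \<in> I \<Longrightarrow> (\<lambda>x. f x j) \<in> borel_measurable M"
  shows "(\<lambda>x. sorted_values I (f x) ! k) \<in> borel_measurable M"
proof -
  have [measurable]: "(\<lambda>x. \<Sum>j\<in>I. indicator {..c} (f x j) :: real) \<in> borel_measurable M" for c
    using M by (intro borel_measurable_sum) (auto intro!: measurable_compose[OF M])
  then show ?thesis
    unfolding borel_measurable_iff_le sorted_values_nth_le_iff[OF assms(1)] by (intro allI) measurable
qed

text \<open>The right end point \<open>t\<close> is a parameter because conditioning on the maximum \<open>v\<close> of the sample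
  leaves a sample on \<open>{0<..<v}\<close>: this is what the induction below runs on.\<close>

definition padded_stat :: "'i set \<Rightarrow> real \<Rightarrow> ('i \<Rightarrow> real) \<Rightarrow> nat \<Rightarrow> real" where
  "padded_stat I t u k =
     (if k = 0 then 0 else if k = Suc (card I) then t else sorted_values I u ! (k - 1))"

text \<open>A sample of \<open>card I\<close> points has \<open>card I + 1\<close> spacings, each
  with its own weight. Weights that are constant on blocks recover sums of coarser spacings by
  telescoping.\<close>

definition spacing_sum :: "(nat \<Rightarrow> real) \<Rightarrow> 'i set \<Rightarrow> real \<Rightarrow> ('i \<Rightarrow> real) \<Rightarrow> real" where
  "spacing_sum z I t u = (\<Sum>k\<le>card I. z k * (padded_stat I t u (Suc k) - padded_stat I t u k))"

lemma measurable_padded_stat: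
  assumes "k \<le> Suc (card I)" "\<And>j. j \<in> I \<Longrightarrow> (\<lambda>x. f x j) \<in> borel_measurable M"
  shows "(\<lambda>x. padded_stat I t (f x) k) \<in> borel_measurable M"
proof (cases "k = 0 \<or> k = Suc (card I)")
  case False
  with assms(1) have "(\<lambda>x. sorted_values I (f x) ! (k - 1)) \<in> borel_measurable M"
    by (intro measurable_sorted_values_nth assms(2)) auto
  with False show ?thesis by (simp add: padded_stat_def)
qed (auto simp: padded_stat_def)

lemma measurable_spacing_sum:
  assumes "\<And>j. j \<in> I \<Longrightarrow> (\<lambda>x. f x j) \<in> borel_measurable M"
  shows "(\<lambda>x. spacing_sum z I t (f x)) \<in> borel_measurable M"
  unfolding spacing_sum_def
  by (intro borel_measurable_sum borel_measurable_times borel_measurable_diff borel_measurable_const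
       measurable_padded_stat assms) auto

lemma padded_stat_mono:
  assumes "finite I" "0 \<le> t" "\<And>j. j \<in> I \<Longrightarrow> u j \<in> {0..t}" "k \<le> card I"
  shows "padded_stat I t u k \<le> padded_stat I t u (Suc k)"
proof -
  have mem: "sorted_values I u ! l \<in> {0..t}" if "l < card I" for l
    using nth_mem[of l "sorted_values I u"] that assms(1,3) by auto
  show ?thesis
  proof (cases k)
    case 0
    then show ?thesis using assms(2) mem[of 0] by (cases "card I = 0") (auto simp: padded_stat_def)
  next
    case (Suc l)
    then show ?thesis
      using assms(4) mem[of l] sorted_nth_mono[OF sorted_sorted_values, of l k I u]
      by (cases "k = card I") (auto simp: padded_stat_def)
  qed
qed

lemma spacing_sum_nonneg:
  assumes "finite I" "0 \<le> t" "\<And>j. j \<in> I \<Longrightarrow> u j \<in> {0..t}" "\<And>k. 0 \<le> z k"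
  shows "0 \<le> spacing_sum z I t u"
  unfolding spacing_sum_def
  using assms by (intro sum_nonneg mult_nonneg_nonneg) (auto simp: padded_stat_mono)

text \<open>Only the last spacing sees \<open>t\<close>; for the spacings to its left, the maximum
  \<open>v\<close> is the right end point.\<close>

lemma spacing_sum_insert_max:
  assumes "finite I" "i \<notin> I" "\<And>j. j \<in> I \<Longrightarrow> u j \<le> v"
  shows "spacing_sum z (insert i I) t (u(i := v)) = spacing_sum z I v u + z (Suc (card I)) * (t - v)"
proof -
  have stat: "padded_stat (insert i I) t (u(i := v)) k = padded_stat I v u k" if "k \<le> Suc (card I)" for k
    using assms that by (auto simp: padded_stat_def sorted_values_insert_max nth_append)
  have last: "padded_stat (insert i I) t (u(i := v)) (Suc (Suc (card I))) = t"
    using assms by (simp add: padded_stat_def)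
  have "spacing_sum z (insert i I) t (u(i := v))
      = (\<Sum>k\<le>card I. z k * (padded_stat (insert i I) t (u(i := v)) (Suc k) - padded_stat (insert i I) t (u(i := v)) k))
        + z (Suc (card I)) * (t - padded_stat I v u (Suc (card I)))"
    using assms by (simp add: spacing_sum_def last stat)
  also have "\<dots> = spacing_sum z I v u + z (Suc (card I)) * (t - v)"
    by (simp add: spacing_sum_def stat padded_stat_def[of I v u "Suc (card I)"])
  finally show ?thesis .
qed

text \<open>Exactly one summand survives, that of the index with the largest value: in any other
  summand the factor of that index vanishes. Injectivity matters because the intervals
  \<open>{0<..<u i}\<close> are open, so a tie at the top would kill every summand.\<close>

lemma prod_indicator_eq_sum_over_max:
  fixes u :: "'i \<Rightarrow> real"
  assumes I: "finite I" "I \<noteq> {}" and inj: "inj_on u I"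
  shows "(\<Prod>j\<in>I. indicator {0<..<t} (u j) :: ennreal)
    = (\<Sum>i\<in>I. indicator {0<..<t} (u i) * (\<Prod>j\<in>I - {i}. indicator {0<..<u i} (u j)))"
proof -
  have "Max (u ` I) \<in> u ` I" using I by simp
  then obtain i where i: "i \<in> I" "Max (u ` I) = u i" by auto
  have less: "u j < u i" if "j \<in> I - {i}" for j
    using that i I inj Max_ge[of "u ` I" "u j"] by (fastforce simp: inj_on_def less_le)
  have "(\<Sum>l\<in>I - {i}. indicator {0<..<t} (u l) * (\<Prod>j\<in>I - {l}. indicator {0<..<u l} (u j) :: ennreal)) = 0"
  proof (rule sum.neutral, rule)
    fix l assume l: "l \<in> I - {i}"
    then have "(\<Prod>j\<in>I - {l}. indicator {0<..<u l} (u j) :: ennreal) = 0"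
      using less[OF l] i(1) I(1) by (intro prod_zero) (auto intro!: bexI[of _ i])
    then show "indicator {0<..<t} (u l) * (\<Prod>j\<in>I - {l}. indicator {0<..<u l} (u j) :: ennreal) = 0"
      by simp
  qed
  then have "(\<Sum>l\<in>I. indicator {0<..<t} (u l) * (\<Prod>j\<in>I - {l}. indicator {0<..<u l} (u j) :: ennreal))
      = indicator {0<..<t} (u i) * (\<Prod>j\<in>I - {i}. indicator {0<..<u i} (u j))"
    by (simp only: sum.remove[OF I(1) i(1)] add_0_right)
  also have "\<dots> = indicator {0<..<t} (u i) * (\<Prod>j\<in>I - {i}. indicator {0<..<t} (u j))"
  proof (cases "u i \<in> {0<..<t}")
    case True
    then have "(\<Prod>j\<in>I - {i}. indicator {0<..<u i} (u j) :: ennreal) = (\<Prod>j\<in>I - {i}. indicator {0<..<t} (u j))"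
      by (intro prod.cong refl) (use less in \<open>force simp: indicator_def\<close>)
    then show ?thesis by simp
  qed simp
  also have "\<dots> = (\<Prod>j\<in>I. indicator {0<..<t} (u j))"
    using I i by (simp add: prod.remove)
  finally show ?thesis by simp
qed

lemma nn_integral_unit_uniform_power_mult_power:
  assumes "0 \<le> t" "t \<le> 1"
  shows "(\<integral>\<^sup>+v. indicator {0<..<t} v * ennreal (v ^ i * (t - v) ^ j) \<partial>unit_uniform)
           = ennreal (fact i * fact j / fact (i + j + 1) * t ^ (i + j + 1))"
proof -
  have "(\<integral>\<^sup>+v. indicator {0<..<t} v * ennreal (v ^ i * (t - v) ^ j) \<partial>unit_uniform)
      = (\<integral>\<^sup>+v. ennreal (indicator {0<..<t} v * (v ^ i * (t - v) ^ j)) \<partial>lborel)"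
    using assms by (subst nn_integral_unit_uniform_initial) (auto simp: ennreal_mult' ennreal_indicator)
  then show ?thesis using assms by (simp add: nn_integral_power_mult_power)
qed

text \<open>Induction on the sample size. With the maximum at \<open>v\<close>, the binomial theorem
  expands the power of (sum over the smaller sample) + (last weight) * \<open>(t - v)\<close>;
  integrating over \<open>v\<close> turns the expansion into the Cauchy product with one more
  geometric series. The index set is arbitrary because the index of the maximum, which may be any,
  is removed. The power of \<open>t\<close> combines the volume \<open>t ^ N\<close> of the cube
  with the scaling \<open>t ^ m\<close> of the integrand.\<close>

lemma nn_integral_spacing_sum_power:
  assumes "finite I" "card I = N" "0 \<le> t" "t \<le> 1" and z: "\<And>k. 0 \<le> z k"
  shows "(\<integral>\<^sup>+u. (\<Prod>j\<in>I. indicator {0<..<t} (u j)) * ennreal (spacing_sum z I t u ^ m)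
            \<partial>Pi\<^sub>M I (\<lambda>_. unit_uniform))
    = ennreal (fact N * fact m / fact (m + N) * t ^ (m + N) * (\<Prod>k\<le>N. rising_fps 1 (z k)) $ m)"
  using assms(1-4)
proof (induction N arbitrary: I t m)
  case 0
  interpret product_prob_space "\<lambda>_. unit_uniform" by (rule product_prob_space_unit_uniform)
  have "emeasure (Pi\<^sub>M ({} :: 'a set) (\<lambda>_. unit_uniform)) (space (Pi\<^sub>M {} (\<lambda>_. unit_uniform))) = 1"
    by (intro prob_space.emeasure_space_1 prob_space_PiM prob_space_unit_uniform)
  with 0 show ?case
    by (simp add: nn_integral_empty spacing_sum_def padded_stat_def rising_fps_1_nth power_mult_distrib mult.commute)
next
  case (Suc N)
  interpret product_prob_space "\<lambda>_. unit_uniform" by (rule product_prob_space_unit_uniform)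
  let ?U = "unit_uniform" and ?c = "\<Prod>k\<le>N. rising_fps 1 (z k)" and ?Z = "z (Suc N)"
  let ?r = "fact N * fact m / fact (m + Suc N) * t ^ (m + Suc N) * (\<Prod>k\<le>Suc N. rising_fps 1 (z k)) $ m"
  have I: "finite I" "card I = Suc N" "I \<noteq> {}" using Suc.prems by auto
  have c_nonneg: "0 \<le> ?c $ q" for q
    using z by (intro fps_prod_nth_nonneg rising_fps_nonneg) auto
  have meas_U: "(\<lambda>v. indicator {0<..<t} v * ennreal (v ^ i * (t - v) ^ j)) \<in> borel_measurable ?U" for i j
    by (subst measurable_cong_sets[OF sets_uniform_measure refl]) measurable
  have meas_comp [measurable]: "(\<lambda>u. u j) \<in> borel_measurable (Pi\<^sub>M J (\<lambda>_. ?U))" if "j \<in> J" for J and j :: 'a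
    using measurable_component_singleton[OF that, of "\<lambda>_. ?U"] measurable_cong_sets[OF refl, of ?U borel]
    by auto
  have meas_sum [measurable]: "(\<lambda>u. spacing_sum z J s u) \<in> borel_measurable (Pi\<^sub>M J (\<lambda>_. ?U))" for J :: "'a set" and s
    by (intro measurable_spacing_sum meas_comp)
  have meas_term: "(\<lambda>u. indicator {0<..<t} (u i) * (\<Prod>j\<in>I - {i}. indicator {0<..<u i} (u j))
        * ennreal (spacing_sum z I t u ^ m)) \<in> borel_measurable (Pi\<^sub>M I (\<lambda>_. ?U))" if i: "i \<in> I" for i
  proof -
    have "(\<lambda>u. indicator {0<..<u i} (u j) :: ennreal) \<in> borel_measurable (Pi\<^sub>M I (\<lambda>_. ?U))" if "j \<in> I - {i}" for j
    proof -
      have [measurable]: "(\<lambda>u. u j) \<in> borel_measurable (Pi\<^sub>M I (\<lambda>_. ?U))" "(\<lambda>u. u i) \<in> borel_measurable (Pi\<^sub>M I (\<lambda>_. ?U))"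
        using i that by (auto intro: meas_comp)
      have "(\<lambda>u. if 0 < u j \<and> u j < u i then 1 else 0 :: ennreal) \<in> borel_measurable (Pi\<^sub>M I (\<lambda>_. ?U))"
        by measurable
      then show ?thesis by (simp add: indicator_def)
    qed
    then have [measurable]: "(\<lambda>u. \<Prod>j\<in>I - {i}. indicator {0<..<u i} (u j) :: ennreal) \<in> borel_measurable (Pi\<^sub>M I (\<lambda>_. ?U))"
      by (rule borel_measurable_prod_ennreal)
    have [measurable]: "(\<lambda>u. u i) \<in> borel_measurable (Pi\<^sub>M I (\<lambda>_. ?U))"
      using i by (rule meas_comp)
    show "(\<lambda>u. indicator {0<..<t} (u i) * (\<Prod>j\<in>I - {i}. indicator {0<..<u i} (u j))
        * ennreal (spacing_sum z I t u ^ m)) \<in> borel_measurable (Pi\<^sub>M I (\<lambda>_. ?U))"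
      by measurable
  qed
  have max_term: "(\<integral>\<^sup>+u. indicator {0<..<t} (u i) * (\<Prod>j\<in>I - {i}. indicator {0<..<u i} (u j))
        * ennreal (spacing_sum z I t u ^ m) \<partial>Pi\<^sub>M I (\<lambda>_. ?U)) = ennreal ?r" (is "?lhs = _")
    if i: "i \<in> I" for i
  proof -
    define J where "J = I - {i}"
    have J: "finite J" "i \<notin> J" "I = insert i J" "card J = N" using I i by (auto simp: J_def)
    let ?P = "\<lambda>v u. \<Prod>j\<in>J. indicator {0<..<v} (u j) :: ennreal"
    \<comment> \<open>\<open>K q\<close> gathers the part of the \<open>q\<close>-th binomial term
      that is independent of \<open>v\<close>: the binomial coefficient, the power of the last
      weight and the constant from the induction hypothesis for the exponent
      \<open>q\<close>.\<close>
    define K where "K q = real (m choose q) * ?Z ^ (m - q) * (fact N * fact q / fact (q + N) * ?c $ q)" for q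
    have K_nonneg: "0 \<le> K q" for q
      unfolding K_def using z c_nonneg by simp
    note mi = meas_term[OF i, folded J_def]
    have inner: "(\<integral>\<^sup>+u. ?P v u * ennreal (spacing_sum z I t (u(i := v)) ^ m) \<partial>Pi\<^sub>M J (\<lambda>_. ?U))
        = (\<Sum>q\<le>m. ennreal (K q) * ennreal (v ^ (q + N) * (t - v) ^ (m - q)))" if v: "v \<in> {0<..<t}" for v
    proof -
      have "(\<integral>\<^sup>+u. ?P v u * ennreal (spacing_sum z I t (u(i := v)) ^ m) \<partial>Pi\<^sub>M J (\<lambda>_. ?U))
          = (\<integral>\<^sup>+u. (\<Sum>q\<le>m. ennreal (real (m choose q) * (?Z * (t - v)) ^ (m - q)) *
               (?P v u * ennreal (spacing_sum z J v u ^ q))) \<partial>Pi\<^sub>M J (\<lambda>_. ?U))"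
      proof (rule nn_integral_cong)
        fix u :: "'a \<Rightarrow> real"
        show "?P v u * ennreal (spacing_sum z I t (u(i := v)) ^ m)
          = (\<Sum>q\<le>m. ennreal (real (m choose q) * (?Z * (t - v)) ^ (m - q)) * (?P v u * ennreal (spacing_sum z J v u ^ q)))"
        \<comment> \<open>Off the cube \<open>v\<close> need not be the maximum and the spacing sum
          may be negative, but there the product of indicators makes both sides 0.\<close>
        proof (cases "\<forall>j\<in>J. u j \<in> {0<..<v}")
          case True
          then have one: "?P v u = 1" by (intro prod.neutral) auto
          have nonneg: "0 \<le> spacing_sum z J v u"
            using True J(1) v z by (intro spacing_sum_nonneg) (auto intro: less_imp_le)
          have "spacing_sum z I t (u(i := v)) = spacing_sum z J v u + ?Z * (t - v)"
            unfolding J(3) using J True by (subst spacing_sum_insert_max) (auto intro: less_imp_le)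
          then have "ennreal (spacing_sum z I t (u(i := v)) ^ m)
              = ennreal (\<Sum>q\<le>m. real (m choose q) * (?Z * (t - v)) ^ (m - q) * spacing_sum z J v u ^ q)"
            by (simp add: binomial_ring mult_ac)
          also have "\<dots> = (\<Sum>q\<le>m. ennreal (real (m choose q) * (?Z * (t - v)) ^ (m - q)) * ennreal (spacing_sum z J v u ^ q))"
          proof -
            have 1: "0 \<le> real (m choose q) * (?Z * (t - v)) ^ (m - q)" "0 \<le> spacing_sum z J v u ^ q" for q
              using z v nonneg by simp_all
            show ?thesis
              by (subst sum_ennreal[symmetric]) (intro mult_nonneg_nonneg 1 sum.cong refl ennreal_mult)+
          qed
          finally show ?thesis using one by simp
        next
          case False
          then have "?P v u = 0" using J(1) by (intro prod_zero) (auto simp: indicator_def)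
          then show ?thesis by (simp only: mult_zero_left mult_zero_right sum.neutral_const)
        qed
      qed
      also have "\<dots> = (\<Sum>q\<le>m. \<integral>\<^sup>+u. ennreal (real (m choose q) * (?Z * (t - v)) ^ (m - q)) *
               (?P v u * ennreal (spacing_sum z J v u ^ q)) \<partial>Pi\<^sub>M J (\<lambda>_. ?U))"
        by (intro nn_integral_sum) measurable
      also have "\<dots> = (\<Sum>q\<le>m. ennreal (real (m choose q) * (?Z * (t - v)) ^ (m - q)) *
            ennreal (fact N * fact q / fact (q + N) * v ^ (q + N) * ?c $ q))"
        \<comment> \<open>The induction hypothesis is used for the index set \<open>J\<close>, the
          exponent \<open>q\<close> and the right end point \<open>v\<close>.\<close>
        using J v Suc.prems by (subst nn_integral_cmult) (measurable, simp add: Suc.IH)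
      also have "\<dots> = (\<Sum>q\<le>m. ennreal (K q) * ennreal (v ^ (q + N) * (t - v) ^ (m - q)))"
        unfolding K_def using v z c_nonneg
        by (intro sum.cong refl) (simp add: ennreal_mult[symmetric] power_mult_distrib mult_ac)
      finally show ?thesis .
    qed
    have "?lhs = (\<integral>\<^sup>+v. (\<integral>\<^sup>+u. indicator {0<..<t} v *
          (?P v u * ennreal (spacing_sum z I t (u(i := v)) ^ m)) \<partial>Pi\<^sub>M J (\<lambda>_. ?U)) \<partial>?U)"
    proof -
      have upd: "(\<Prod>j\<in>J. indicator {0<..<(u(i := v)) i} ((u(i := v)) j) :: ennreal) = ?P v u" for u v
        using J(2) by (intro prod.cong) auto
      have "?lhs = (\<integral>\<^sup>+u. indicator {0<..<t} (u i) * (\<Prod>j\<in>J. indicator {0<..<u i} (u j))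
        * ennreal (spacing_sum z I t u ^ m) \<partial>Pi\<^sub>M (insert i J) (\<lambda>_. ?U))"
        unfolding J_def[symmetric] J(3)[symmetric] ..
      also have "\<dots> = (\<integral>\<^sup>+v. (\<integral>\<^sup>+u. indicator {0<..<t} ((u(i := v)) i) *
          (\<Prod>j\<in>J. indicator {0<..<(u(i := v)) i} ((u(i := v)) j)) * ennreal (spacing_sum z I t (u(i := v)) ^ m)
            \<partial>Pi\<^sub>M J (\<lambda>_. ?U)) \<partial>?U)"
        \<comment> \<open>The integral over the maximum is put outside, so that \<open>v\<close> is
          fixed while the remaining points are integrated out.\<close>
        using J(1,2) mi[unfolded J(3)] unfolding J(3) by (rule product_nn_integral_insert_rev)
      finally show ?thesis unfolding upd by (simp add: mult.assoc)
    qed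
    also have "\<dots> = (\<integral>\<^sup>+v. (\<Sum>q\<le>m. ennreal (K q) *
        (indicator {0<..<t} v * ennreal (v ^ (q + N) * (t - v) ^ (m - q)))) \<partial>?U)"
    proof (rule nn_integral_cong)
      fix v
      show "(\<integral>\<^sup>+u. indicator {0<..<t} v * (?P v u * ennreal (spacing_sum z I t (u(i := v)) ^ m)) \<partial>Pi\<^sub>M J (\<lambda>_. ?U))
        = (\<Sum>q\<le>m. ennreal (K q) * (indicator {0<..<t} v * ennreal (v ^ (q + N) * (t - v) ^ (m - q))))"
        by (cases "v \<in> {0<..<t}") (use inner in simp_all)
    qed
    also have "\<dots> = (\<Sum>q\<le>m. \<integral>\<^sup>+v. ennreal (K q) *
        (indicator {0<..<t} v * ennreal (v ^ (q + N) * (t - v) ^ (m - q))) \<partial>?U)"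
      by (intro nn_integral_sum borel_measurable_times_ennreal measurable_const meas_U) simp
    also have "\<dots> = (\<Sum>q\<le>m. ennreal (K q) * ennreal (fact (q + N) * fact (m - q) / fact (m + Suc N) * t ^ (m + Suc N)))"
      using Suc.prems
      by (intro sum.cong refl) (simp add: nn_integral_cmult[OF meas_U] nn_integral_unit_uniform_power_mult_power add_ac)
    also have "\<dots> = (\<Sum>q\<le>m. ennreal (fact N * fact m / fact (m + Suc N) * t ^ (m + Suc N) * (?c $ q * ?Z ^ (m - q))))"
    proof (intro sum.cong refl)
      fix q assume "q \<in> {..m}"
      \<comment> \<open>The Beta integral over \<open>v\<close> supplies
        \<open>fact (q + N)\<close>, cancelling the denominator in \<open>K q\<close>;
        \<open>fact q * fact (m - q)\<close> combines with the binomial coefficient to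
        \<open>fact m\<close>.\<close>
      then have eq: "K q * (fact (q + N) * fact (m - q) / fact (m + Suc N) * t ^ (m + Suc N))
        = fact N * fact m / fact (m + Suc N) * t ^ (m + Suc N) * (?c $ q * ?Z ^ (m - q))"
        unfolding K_def by (simp add: binomial_fact field_simps)
      show "ennreal (K q) * ennreal (fact (q + N) * fact (m - q) / fact (m + Suc N) * t ^ (m + Suc N))
        = ennreal (fact N * fact m / fact (m + Suc N) * t ^ (m + Suc N) * (?c $ q * ?Z ^ (m - q)))"
        unfolding eq[symmetric] using K_nonneg Suc.prems by (intro ennreal_mult[symmetric]) simp_all
    qed
    also have "\<dots> = ennreal (\<Sum>q\<le>m. fact N * fact m / fact (m + Suc N) * t ^ (m + Suc N) * (?c $ q * ?Z ^ (m - q)))"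
      using c_nonneg z Suc.prems by (intro sum_ennreal) simp
    also have "\<dots> = ennreal ?r"
      by (simp add: fps_mult_nth atLeast0AtMost rising_fps_1_nth sum_distrib_left del: fact_Suc)
    finally show ?thesis .
  qed
  have "(\<integral>\<^sup>+u. (\<Prod>j\<in>I. indicator {0<..<t} (u j)) * ennreal (spacing_sum z I t u ^ m) \<partial>Pi\<^sub>M I (\<lambda>_. ?U))
    = (\<integral>\<^sup>+u. (\<Sum>i\<in>I. indicator {0<..<t} (u i) * (\<Prod>j\<in>I - {i}. indicator {0<..<u i} (u j))
        * ennreal (spacing_sum z I t u ^ m)) \<partial>Pi\<^sub>M I (\<lambda>_. ?U))"
    \<comment> \<open>The decomposition by the maximum holds off the null set of ties.\<close>
    using AE_unit_uniform_inj_on[OF I(1)]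
    by (intro nn_integral_cong_AE, eventually_elim)
       (simp add: prod_indicator_eq_sum_over_max[OF I(1,3)] sum_distrib_right)
  also have "\<dots> = (\<Sum>i\<in>I. \<integral>\<^sup>+u. indicator {0<..<t} (u i) * (\<Prod>j\<in>I - {i}. indicator {0<..<u i} (u j))
        * ennreal (spacing_sum z I t u ^ m) \<partial>Pi\<^sub>M I (\<lambda>_. ?U))"
    by (rule nn_integral_sum) (rule meas_term)
  \<comment> \<open>By symmetry each choice of the maximal index contributes the same amount; their
    number raises \<open>fact N\<close> to \<open>fact (Suc N)\<close>.\<close>
  also have "\<dots> = of_nat (Suc N) * ennreal ?r"
    using I max_term by simp
  also have "\<dots> = ennreal (real (Suc N) * ?r)"
    by (simp only: ennreal_of_nat_eq_real_of_nat ennreal_mult'[symmetric] of_nat_0_le_iff)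
  also have "real (Suc N) * ?r = fact (Suc N) * fact m / fact (m + Suc N) * t ^ (m + Suc N) * (\<Prod>k\<le>Suc N. rising_fps 1 (z k)) $ m"
    by (simp add: mult_ac)
  finally show ?case .
qed

section \<open>From single spacings to blocks of spacings\<close>

lemma order_stat_eq_padded_stat:
  assumes "0 < n"
  shows "order_stat n y k = padded_stat {1..<n} 1 y k"
proof -
  have "sort (map y [1..<n]) = sorted_values {1..<n} y"
    by (metis sorted_values_def sorted_list_of_multiset_mset mset_map mset_upt)
  then show ?thesis using assms by (simp add: order_stat_def padded_stat_def)
qed

lemma padded_stat_cong:
  "(\<And>j. j \<in> I \<Longrightarrow> u j = v j) \<Longrightarrow> padded_stat I t u k = padded_stat I t v k"
proof -
  assume "\<And>j. j \<in> I \<Longrightarrow> u j = v j"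
  then have "image_mset u (mset_set I) = image_mset v (mset_set I)"
    by (cases "finite I") (auto intro: image_mset_cong)
  then show ?thesis by (simp add: padded_stat_def sorted_values_def)
qed

text \<open>Stated for commutative monoids because both instances occur: sums for the spacings,
  products for the series. The inequality is carried through the induction since gluing intervals
  requires it; it also yields monotonicity of \<open>ns\<close> later on.\<close>

lemma (in comm_monoid_set) concat_blocks:
  fixes ns :: "nat \<Rightarrow> nat"
  assumes "\<And>j. j < k \<Longrightarrow> ns j \<le> ns (Suc j)"
  shows "F (\<lambda>j. F g {ns j..<ns (Suc j)}) {..<k} = F g {ns 0..<ns k}" and "ns 0 \<le> ns k"
proof -
  have "F (\<lambda>j. F g {ns j..<ns (Suc j)}) {..<k} = F g {ns 0..<ns k} \<and> ns 0 \<le> ns k"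
    using assms
  proof (induction k)
    case (Suc k)
    then have IH: "F (\<lambda>j. F g {ns j..<ns (Suc j)}) {..<k} = F g {ns 0..<ns k}" "ns 0 \<le> ns k"
      by simp_all
    have "ns k \<le> ns (Suc k)" by (rule Suc.prems) simp
    then show ?case
      using IH atLeastLessThan_concat[of "ns 0" "ns k" "ns (Suc k)" g] by (simp add: commute)
  qed simp
  then show "F (\<lambda>j. F g {ns j..<ns (Suc j)}) {..<k} = F g {ns 0..<ns k}" "ns 0 \<le> ns k" by auto
qed

lemma obtain_block_index:
  fixes ns :: "nat \<Rightarrow> nat"
  assumes "\<And>j. j < k \<Longrightarrow> ns j \<le> ns (Suc j)"
  obtains blk where "\<And>j l. j < k \<Longrightarrow> l \<in> {ns j..<ns (Suc j)} \<Longrightarrow> blk l = Suc j"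
\<comment> \<open>The index of the first break point beyond \<open>l\<close>. On the block from
  \<open>ns j\<close> to \<open>ns (Suc j)\<close> this is \<open>Suc j\<close>, matching weights
  numbered from 1.\<close>
proof (rule that[of "\<lambda>l. LEAST i. l < ns i"])
  fix j l assume j: "j < k" and l: "l \<in> {ns j..<ns (Suc j)}"
  have mono: "ns i \<le> ns j" if "i \<le> j" for i
    using that j
  proof (induction j)
    case (Suc j)
    then show ?case using assms[of j] by (cases "i = Suc j") (auto simp: le_Suc_eq)
  qed simp
  show "(LEAST i. l < ns i) = Suc j"
  proof (rule Least_equality)
    fix i assume "l < ns i"
    then show "Suc j \<le> i" using mono[of i] l by (force simp: not_less_eq_eq[symmetric])
  qed (use l in simp)
qed

text \<open>Every spacing in a block receives the weight \<open>x (Suc j)\<close> of that block. The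
  weighted spacings then telescope to the block weights, and the equal geometric series of a block
  multiply to a single \<open>rising_fps\<close> whose exponent is the block length.\<close>

lemma (in prob_space) nn_integral_weighted_blocks:
  fixes Y :: "nat \<Rightarrow> 'a \<Rightarrow> real" and ns :: "nat \<Rightarrow> nat" and x :: "nat \<Rightarrow> real"
  assumes n: "2 \<le> n" and ns: "ns 0 = 0" "ns k = n" "\<And>j. j < k \<Longrightarrow> ns j \<le> ns (Suc j)"
    and indep: "indep_vars (\<lambda>_. borel) Y {1..<n}"
    and unif: "\<And>i. i \<in> {1..<n} \<Longrightarrow> distr M borel (Y i) = unit_uniform"
    and x: "\<And>j. 0 \<le> x j"
  shows "(\<integral>\<^sup>+\<omega>. ennreal ((\<Sum>j<k. (order_stat n (\<lambda>i. Y i \<omega>) (ns (Suc j)) - order_stat n (\<lambda>i. Y i \<omega>) (ns j))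
              * x (Suc j)) ^ m) \<partial>M)
    = ennreal (fact m / pochhammer (real n) m * (\<Prod>j<k. rising_fps (real (ns (Suc j) - ns j)) (x (Suc j))) $ m)"
proof -
  let ?I = "{1..<n}" and ?U = "unit_uniform"
  obtain blk where blk: "\<And>j l. j < k \<Longrightarrow> l \<in> {ns j..<ns (Suc j)} \<Longrightarrow> blk l = Suc j"
    using obtain_block_index[of k ns] ns(3) by metis
  define z where "z l = x (blk l)" for l
  have card: "Suc (card ?I) = n" "card ?I = n - 1" using n by auto
  have rv: "random_variable borel (Y i)" if "i \<in> ?I" for i
    using indep that unfolding indep_vars_def by auto
  have blocks: "(\<Sum>j<k. (padded_stat ?I 1 u (ns (Suc j)) - padded_stat ?I 1 u (ns j)) * x (Suc j))
      = spacing_sum z ?I 1 u" for u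
  proof -
    have "(\<Sum>j<k. (padded_stat ?I 1 u (ns (Suc j)) - padded_stat ?I 1 u (ns j)) * x (Suc j))
        = (\<Sum>j<k. \<Sum>l=ns j..<ns (Suc j). z l * (padded_stat ?I 1 u (Suc l) - padded_stat ?I 1 u l))"
    proof (rule sum.cong[OF refl])
      fix j assume j: "j \<in> {..<k}"
      have "(\<Sum>l=ns j..<ns (Suc j). z l * (padded_stat ?I 1 u (Suc l) - padded_stat ?I 1 u l))
          = (\<Sum>l=ns j..<ns (Suc j). x (Suc j) * (padded_stat ?I 1 u (Suc l) - padded_stat ?I 1 u l))"
        using j blk by (intro sum.cong refl) (simp add: z_def)
      also have "\<dots> = x (Suc j) * (padded_stat ?I 1 u (ns (Suc j)) - padded_stat ?I 1 u (ns j))"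
        using ns(3)[of j] j by (simp add: sum_distrib_left[symmetric] sum_Suc_diff')
      finally show "(padded_stat ?I 1 u (ns (Suc j)) - padded_stat ?I 1 u (ns j)) * x (Suc j)
          = (\<Sum>l=ns j..<ns (Suc j). z l * (padded_stat ?I 1 u (Suc l) - padded_stat ?I 1 u l))"
        by simp
    qed
    also have "\<dots> = (\<Sum>l=ns 0..<ns k. z l * (padded_stat ?I 1 u (Suc l) - padded_stat ?I 1 u l))"
      by (rule sum.concat_blocks) (rule ns(3))
    also have "{ns 0..<ns k} = {..card ?I}" using n ns by auto
    finally show ?thesis unfolding spacing_sum_def .
  qed
  have prod_blocks: "(\<Prod>l\<le>n - 1. rising_fps 1 (z l)) = (\<Prod>j<k. rising_fps (real (ns (Suc j) - ns j)) (x (Suc j)))"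
  proof -
    have "{..n - 1} = {ns 0..<ns k}" using n ns by auto
    then have "(\<Prod>l\<le>n - 1. rising_fps 1 (z l)) = (\<Prod>j<k. \<Prod>l=ns j..<ns (Suc j). rising_fps 1 (z l))"
      using prod.concat_blocks(1)[of k ns "\<lambda>l. rising_fps 1 (z l)"] ns(3) by simp
    also have "\<dots> = (\<Prod>j<k. rising_fps (real (ns (Suc j) - ns j)) (x (Suc j)))"
    proof (rule prod.cong[OF refl])
      fix j assume "j \<in> {..<k}"
      then have "(\<Prod>l=ns j..<ns (Suc j). rising_fps 1 (z l)) = (\<Prod>l=ns j..<ns (Suc j). rising_fps 1 (x (Suc j)))"
        using blk by (intro prod.cong refl) (simp add: z_def)
      then show "(\<Prod>l=ns j..<ns (Suc j). rising_fps 1 (z l)) = rising_fps (real (ns (Suc j) - ns j)) (x (Suc j))"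
        by (simp add: rising_fps_power)
    qed
    finally show ?thesis .
  qed
  have comp: "(\<lambda>u. u j) \<in> borel_measurable (Pi\<^sub>M ?I (\<lambda>_. borel))" if "j \<in> ?I" for j
    using that by measurable
  have joint: "distr M (Pi\<^sub>M ?I (\<lambda>_. borel)) (\<lambda>\<omega>. \<lambda>i\<in>?I. Y i \<omega>) = Pi\<^sub>M ?I (\<lambda>_. ?U)"
  proof -
    have "distr M (Pi\<^sub>M ?I (\<lambda>_. borel)) (\<lambda>\<omega>. \<lambda>i\<in>?I. Y i \<omega>) = Pi\<^sub>M ?I (\<lambda>i. distr M borel (Y i))"
      using n rv indep by (subst indep_vars_iff_distr_eq_PiM'[symmetric]) auto
    also have "\<dots> = Pi\<^sub>M ?I (\<lambda>_. ?U)" by (rule PiM_cong) (auto simp: unif)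
    finally show ?thesis .
  qed
  have rv_joint: "(\<lambda>\<omega>. \<lambda>i\<in>?I. Y i \<omega>) \<in> measurable M (Pi\<^sub>M ?I (\<lambda>_. borel))"
    using rv by (intro measurable_restrict) auto
  have "(\<integral>\<^sup>+\<omega>. ennreal ((\<Sum>j<k. (order_stat n (\<lambda>i. Y i \<omega>) (ns (Suc j)) - order_stat n (\<lambda>i. Y i \<omega>) (ns j))
              * x (Suc j)) ^ m) \<partial>M)
      = (\<integral>\<^sup>+\<omega>. ennreal (spacing_sum z ?I 1 (\<lambda>i\<in>?I. Y i \<omega>) ^ m) \<partial>M)"
  proof (rule nn_integral_cong)
    fix \<omega>
    have "order_stat n (\<lambda>i. Y i \<omega>) l = padded_stat ?I 1 (\<lambda>i\<in>?I. Y i \<omega>) l" for l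
      using n by (subst order_stat_eq_padded_stat) (auto intro!: padded_stat_cong)
    then show "ennreal ((\<Sum>j<k. (order_stat n (\<lambda>i. Y i \<omega>) (ns (Suc j)) - order_stat n (\<lambda>i. Y i \<omega>) (ns j))
              * x (Suc j)) ^ m) = ennreal (spacing_sum z ?I 1 (\<lambda>i\<in>?I. Y i \<omega>) ^ m)"
      by (simp only: blocks)
  qed
  also have "\<dots> = (\<integral>\<^sup>+u. ennreal (spacing_sum z ?I 1 u ^ m) \<partial>distr M (Pi\<^sub>M ?I (\<lambda>_. borel)) (\<lambda>\<omega>. \<lambda>i\<in>?I. Y i \<omega>))"
  proof -
    have "(\<lambda>u. spacing_sum z ?I 1 u) \<in> borel_measurable (Pi\<^sub>M ?I (\<lambda>_. borel))"
      by (intro measurable_spacing_sum comp)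
    then have "(\<lambda>u. ennreal (spacing_sum z ?I 1 u ^ m)) \<in> borel_measurable (Pi\<^sub>M ?I (\<lambda>_. borel))"
      by measurable
    then show ?thesis by (subst nn_integral_distr[OF rv_joint]) simp_all
  qed
  \<comment> \<open>The sample lies in the open unit cube almost surely, so the indicators required
    by the moment formula with \<open>t = 1\<close> can be inserted.\<close>
  also have "\<dots> = (\<integral>\<^sup>+u. (\<Prod>j\<in>?I. indicator {0<..<1} (u j)) * ennreal (spacing_sum z ?I 1 u ^ m) \<partial>Pi\<^sub>M ?I (\<lambda>_. ?U))"
    unfolding joint
  proof (rule nn_integral_cong_AE)
    have "AE u in Pi\<^sub>M ?I (\<lambda>_. ?U). u j \<in> {0<..<1}" if "j \<in> ?I" for j
      using that by (intro AE_PiM_component prob_space_unit_uniform AE_uniform_measureI) auto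
    then have "AE u in Pi\<^sub>M ?I (\<lambda>_. ?U). \<forall>j\<in>?I. u j \<in> {0<..<1}"
      by (intro AE_finite_allI) auto
    then show "AE u in Pi\<^sub>M ?I (\<lambda>_. ?U). ennreal (spacing_sum z ?I 1 u ^ m)
        = (\<Prod>j\<in>?I. indicator {0<..<1} (u j)) * ennreal (spacing_sum z ?I 1 u ^ m)"
    proof eventually_elim
      case (elim u)
      then have "(\<Prod>j\<in>?I. indicator {0<..<1} (u j) :: ennreal) = 1" by (intro prod.neutral) auto
      then show ?case by (simp only: mult_1_left)
    qed
  qed
  also have "\<dots> = ennreal (fact (n - 1) * fact m / fact (m + (n - 1)) * 1 ^ (m + (n - 1)) * (\<Prod>l\<le>n - 1. rising_fps 1 (z l)) $ m)"
    by (rule nn_integral_spacing_sum_power) (auto simp: z_def x)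
  also have "fact (n - 1) * fact m / fact (m + (n - 1)) * 1 ^ (m + (n - 1)) = fact m / pochhammer (real n) m"
  proof -
    have "fact (m + (n - 1)) = fact (n - 1) * pochhammer (real n) m"
      using pochhammer_product'[of "1::real" "n - 1" m] n
      by (simp add: pochhammer_fact[symmetric] add.commute of_nat_diff)
    then show ?thesis by simp
  qed
  finally show ?thesis unfolding prod_blocks .
qed

section \<open>Randomly weighted averages\<close>

lemma beta_density_nonneg: "0 < p \<Longrightarrow> 0 < q \<Longrightarrow> 0 \<le> beta_density a b p q x"
  using Beta_pos_real[of p q] by (auto simp: beta_density_def)

lemma borel_measurable_beta_density [measurable]: "beta_density a b p q \<in> borel_measurable borel"
  unfolding beta_density_def[abs_def] by measurable

text \<open>The factor \<open>b - a\<close> is the Jacobian of the affine map onto the unit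
  interval; in the exponent it is the 1 left over in
  \<open>p + q - 1 = (p - 1) + (q - 1) + 1\<close>.\<close>

lemma beta_density_rescale:
  assumes "a < b"
  shows "beta_density 0 1 p q ((x - a) / (b - a)) = (b - a) * beta_density a b p q x"
proof (cases "a < x \<and> x < b")
  case True
  have 1: "1 - (x - a) / (b - a) = (b - x) / (b - a)" using assms by (simp add: field_simps)
  have "(b - a) powr (p + q - 1) = (b - a) powr (p - 1) * (b - a) powr (q - 1) * (b - a)"
    using assms by (simp add: powr_mult_base mult.commute flip: powr_add)
  then show ?thesis
    using True assms by (simp add: beta_density_def 1 powr_divide)
next
  case False
  then show ?thesis using assms by (auto simp: beta_density_def divide_simps)
qed

lemma (in prob_space) distributed_beta_standardize:
  assumes "a < b" "0 < p" "0 < q"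
    and X: "distributed M lborel X (\<lambda>x. ennreal (beta_density a b p q x))"
  shows "distributed M lborel (\<lambda>\<omega>. (X \<omega> - a) / (b - a)) (\<lambda>x. ennreal (beta_density 0 1 p q x))"
proof -
  have "distributed M lborel (\<lambda>\<omega>. - a / (b - a) + (1 / (b - a)) * X \<omega>)
      (\<lambda>x. ennreal (beta_density a b p q ((x - - a / (b - a)) / (1 / (b - a)))) / ennreal \<bar>1 / (b - a)\<bar>)"
    using X assms by (intro distributed_affine) auto
  moreover have "ennreal (beta_density a b p q ((x - - a / (b - a)) / (1 / (b - a)))) / ennreal \<bar>1 / (b - a)\<bar>
      = ennreal (beta_density 0 1 p q x)" for x
  proof -
    define y where "y = (x - - a / (b - a)) / (1 / (b - a))"
    have "y = x * (b - a) + a" using assms by (simp add: y_def distrib_right)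
    then have "x = (y - a) / (b - a)" using assms by simp
    then have "beta_density 0 1 p q x = (b - a) * beta_density a b p q y"
      using beta_density_rescale[OF assms(1), of p q y] by simp
    then show ?thesis
      using assms beta_density_nonneg[of p q a b y]
      unfolding y_def[symmetric] by (simp add: divide_ennreal mult.commute)
  qed
  ultimately show ?thesis
    using assms by (simp add: diff_divide_distrib add.commute)
qed

lemma (in prob_space) distributed_beta_unstandardize:
  assumes "a < b" "0 < p" "0 < q"
    and X: "distributed M lborel X (\<lambda>x. ennreal (beta_density 0 1 p q x))"
  shows "distributed M lborel (\<lambda>\<omega>. a + (b - a) * X \<omega>) (\<lambda>x. ennreal (beta_density a b p q x))"
proof -
  have "distributed M lborel (\<lambda>\<omega>. a + (b - a) * X \<omega>)
      (\<lambda>x. ennreal (beta_density 0 1 p q ((x - a) / (b - a))) / ennreal \<bar>b - a\<bar>)"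
    using X assms by (intro distributed_affine) auto
  also have "(\<lambda>x. ennreal (beta_density 0 1 p q ((x - a) / (b - a))) / ennreal \<bar>b - a\<bar>)
      = (\<lambda>x. ennreal (beta_density a b p q x))"
    using assms beta_density_nonneg[of p q a b] by (simp add: beta_density_rescale divide_ennreal)
  finally show ?thesis .
qed

lemma real_distribution_beta_density:
  assumes "0 < p" "0 < q"
  shows "real_distribution (density lborel (\<lambda>x. ennreal (beta_density 0 1 p q x)))"
proof -
  have "prob_space (density lborel (\<lambda>x. ennreal (beta_density 0 1 p q x)))"
    using beta_density_moment[OF assms, of 0] by (intro prob_spaceI) (simp add: emeasure_density)
  then show ?thesis
    by (simp add: real_distribution_def real_distribution_axioms_def)
qed

text \<open>Both laws live on \<open>{0..1}\<close>. Hence their moments determine them, and each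
  real moment can be read off from the nonnegative integral.\<close>

lemma (in prob_space) distributed_beta_if_moments:
  assumes "0 < p" "0 < q" and rv [measurable]: "random_variable borel S"
    and bounded: "AE \<omega> in M. S \<omega> \<in> {0..1}"
    and moment: "\<And>m. (\<integral>\<^sup>+\<omega>. ennreal (S \<omega> ^ m) \<partial>M) = ennreal (pochhammer p m / pochhammer (p + q) m)"
  shows "distributed M lborel S (\<lambda>x. ennreal (beta_density 0 1 p q x))"
proof -
  let ?D = "density lborel (\<lambda>x. ennreal (beta_density 0 1 p q x))"
  have "distr M borel S = ?D"
  proof (rule moments_determine_distribution[where C = 1])
    show "real_distribution (distr M borel S)" by simp
    show "real_distribution ?D" using assms(1,2) by (rule real_distribution_beta_density)
    show "AE x in distr M borel S. \<bar>x\<bar> \<le> 1"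
      using bounded by (subst AE_distr_iff) auto
    have D: "AE x in ?D. x \<in> {0..1}"
      by (subst AE_density) (auto simp: beta_density_def)
    then show "AE x in ?D. \<bar>x\<bar> \<le> 1" by eventually_elim auto
    fix m
    have "(\<integral>x. x ^ m \<partial>distr M borel S) = (\<integral>\<omega>. S \<omega> ^ m \<partial>M)"
      by (simp add: integral_distr)
    also have "\<dots> = enn2real (\<integral>\<^sup>+\<omega>. ennreal (S \<omega> ^ m) \<partial>M)"
    proof (rule integral_eq_nn_integral)
      show "AE \<omega> in M. 0 \<le> S \<omega> ^ m" using bounded by eventually_elim simp
    qed simp
    also have "\<dots> = enn2real (\<integral>\<^sup>+x. ennreal (x ^ m) \<partial>?D)"
      by (simp add: moment nn_integral_density beta_density_moment[OF assms(1,2)])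
    also have "\<dots> = (\<integral>x. x ^ m \<partial>?D)"
    proof (rule integral_eq_nn_integral[symmetric])
      show "AE x in ?D. 0 \<le> x ^ m" using D by eventually_elim simp
    qed simp
    finally show "(\<integral>x. x ^ m \<partial>distr M borel S) = (\<integral>x. x ^ m \<partial>?D)" .
  qed
  then have "distr M lborel S = ?D"
    using distr_cong[of M M lborel borel S S] by simp
  then show ?thesis by (simp add: distributed_def)
qed

theorem theorem3p2:
  fixes M :: "'a measure" and n k :: nat and ns :: "nat \<Rightarrow> nat"
    and r s :: "nat \<Rightarrow> real" and a b :: real
    and Y V X :: "nat \<Rightarrow> 'a \<Rightarrow> real"
  assumes "prob_space M"
    and "2 \<le> n" and "2 \<le> k" and "k \<le> n"
    and "ns 0 = 0" and "ns k = n" and "\<And>j. j < k \<Longrightarrow> ns j < ns (Suc j)"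
    and "\<And>j. j \<in> {1..k} \<Longrightarrow> r j = real (ns j) - real (ns (j - 1))"
    and "\<And>i. i \<in> {1..k} \<Longrightarrow> 0 < s i \<and> s i < r i"
    and "a < b"
    and "prob_space.indep_vars M (\<lambda>_. borel) Y {1..n - 1}"
    and "\<And>i. i \<in> {1..n - 1} \<Longrightarrow> distr M lborel (Y i) = uniform_measure lborel {0<..<1}"
    and "\<And>j \<omega>. j \<in> {1..k} \<Longrightarrow>
           V j \<omega> = order_stat n (\<lambda>i. Y i \<omega>) (ns j) - order_stat n (\<lambda>i. Y i \<omega>) (ns (j - 1))"
    and "prob_space.indep_vars M (\<lambda>_. borel) X {1..k}"
    and "prob_space.indep_var M
           (Pi\<^sub>M {1..k} (\<lambda>_. borel)) (\<lambda>\<omega>. \<lambda>j\<in>{1..k}. X j \<omega>)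
           (Pi\<^sub>M {1..k} (\<lambda>_. borel)) (\<lambda>\<omega>. \<lambda>j\<in>{1..k}. V j \<omega>)"
    and "\<And>i. i \<in> {1..k} \<Longrightarrow>
           distributed M lborel (X i) (\<lambda>x. ennreal (beta_density a b (s i) (r i - s i) x))"
  shows "distributed M lborel (\<lambda>\<omega>. \<Sum>j=1..k. V j \<omega> * X j \<omega>)
           (\<lambda>x. ennreal (beta_density a b (\<Sum>i=1..k. s i) ((\<Sum>i=1..k. r i) - (\<Sum>i=1..k. s i)) x))"
proof -
  interpret prob_space M by (rule assms(1))
  let ?J = "{1..k}" and ?I = "{1..<n}"
  let ?\<sigma> = "\<Sum>i=1..k. s i"
  let ?std = "\<lambda>x. (x - a) / (b - a)"
  let ?PJ = "Pi\<^sub>M ?J (\<lambda>_. borel) :: (nat \<Rightarrow> real) measure"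
  note ns = assms(5,6) and ns_mono = less_imp_le[OF assms(7)]
  note s = assms(9) and ab = assms(10) and V = assms(13)
  have I: "?I = {1..n - 1}" using assms(2) by auto
  have r: "r j = real (ns j - ns (j - 1))" if "j \<in> ?J" for j
    using assms(8)[OF that] ns_mono[of "j - 1"] that by (auto simp: of_nat_diff)
  have shift: "(\<Sum>j=1..k. f j) = (\<Sum>j<k. f (Suc j))" for f :: "nat \<Rightarrow> real"
    by (simp add: sum.atLeast1_atMost_eq)
  \<comment> \<open>This holds at every point, by the conventions at indices 0 and \<open>n\<close>.
    It bounds the average by 1 and lets the affine rescaling pass through it.\<close>
  have sum_V: "(\<Sum>j=1..k. V j \<omega>) = 1" for \<omega>
  proof -
    have "(\<Sum>j=1..k. V j \<omega>) = (\<Sum>j<k. order_stat n (\<lambda>i. Y i \<omega>) (ns (Suc j)) - order_stat n (\<lambda>i. Y i \<omega>) (ns j))"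
      unfolding shift by (intro sum.cong) (auto simp: V)
    also have "\<dots> = order_stat n (\<lambda>i. Y i \<omega>) (ns k) - order_stat n (\<lambda>i. Y i \<omega>) (ns 0)"
      by (rule sum_lessThan_telescope)
    finally show ?thesis using ns assms(2) by (simp add: order_stat_def)
  qed
  have sum_r: "(\<Sum>i=1..k. r i) = real n"
  proof -
    have "(\<Sum>i=1..k. r i) = (\<Sum>j<k. real (ns (Suc j)) - real (ns j))"
      unfolding shift by (intro sum.cong) (auto simp: assms(8))
    also have "\<dots> = real n" using ns sum_lessThan_telescope[of "\<lambda>j. real (ns j)" k] by simp
    finally show ?thesis .
  qed
  have \<sigma>: "0 < ?\<sigma>" "0 < real n - ?\<sigma>"
  proof -
    show "0 < ?\<sigma>" using s assms(3) by (intro sum_pos) auto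
    have "?\<sigma> < (\<Sum>i=1..k. r i)" using s assms(3) by (intro sum_strict_mono) auto
    then show "0 < real n - ?\<sigma>" by (simp only: sum_r diff_gt_0_iff_gt)
  qed
  have rvX: "random_variable borel (X j)" if "j \<in> ?J" for j
    using assms(14) that unfolding indep_vars_def by auto
  have rvXs: "random_variable ?PJ (\<lambda>\<omega>. \<lambda>j\<in>?J. X j \<omega>)" and rvVs: "random_variable ?PJ (\<lambda>\<omega>. \<lambda>j\<in>?J. V j \<omega>)"
    and joint: "distr M ?PJ (\<lambda>\<omega>. \<lambda>j\<in>?J. X j \<omega>) \<Otimes>\<^sub>M distr M ?PJ (\<lambda>\<omega>. \<lambda>j\<in>?J. V j \<omega>)
      = distr M (?PJ \<Otimes>\<^sub>M ?PJ) (\<lambda>\<omega>. (\<lambda>j\<in>?J. X j \<omega>, \<lambda>j\<in>?J. V j \<omega>))"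
    using assms(15) unfolding indep_var_distribution_eq by auto
  have rvV: "random_variable borel (V j)" if "j \<in> ?J" for j
    using measurable_compose[OF rvVs measurable_component_singleton[OF that]] that by simp
  have unif: "distr M borel (Y i) = unit_uniform" if "i \<in> ?I" for i
  proof -
    have "distr M borel (Y i) = distr M lborel (Y i)" by (rule distr_cong) auto
    also have "\<dots> = unit_uniform" using that unfolding I by (rule assms(12))
    finally show ?thesis .
  qed
  have rvY: "random_variable borel (Y i)" if "i \<in> ?I" for i
    using assms(11) that unfolding indep_vars_def I by auto
  have X_std: "distributed M lborel (\<lambda>\<omega>. ?std (X j \<omega>)) (\<lambda>x. ennreal (beta_density 0 1 (s j) (r j - s j) x))"
    if "j \<in> ?J" for j
    using s[OF that] ab assms(16)[OF that] by (intro distributed_beta_standardize) auto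

  \<comment> \<open>Only almost sure: where some \<open>Y i\<close> leaves the unit interval, the
    padded sample need not be increasing.\<close>
  have V_nonneg: "AE \<omega> in M. \<forall>j\<in>?J. 0 \<le> V j \<omega>"
  proof -
    have "AE \<omega> in M. Y i \<omega> \<in> {0<..<1}" if "i \<in> ?I" for i
      by (rule AE_distrD[OF rvY[OF that]], subst unif[OF that], rule AE_uniform_measureI) auto
    then have "AE \<omega> in M. \<forall>i\<in>?I. Y i \<omega> \<in> {0<..<1}"
      by (intro AE_finite_allI) auto
    then show ?thesis
    proof eventually_elim
      case (elim \<omega>)
      show ?case
      proof
        fix j assume j: "j \<in> ?J"
        let ?o = "padded_stat ?I 1 (\<lambda>i. Y i \<omega>)"
        have le: "ns (j - 1) \<le> ns j" "ns j \<le> n"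
        proof -
          show "ns (j - 1) \<le> ns j" using ns_mono[of "j - 1"] j by (cases j) auto
          \<comment> \<open>Monotonicity from \<open>j\<close> to \<open>k\<close>, read off from
            the shifted sequence, since \<open>ns\<close> is controlled only up to
            \<open>k\<close>.\<close>
          have "ns (j + 0) \<le> ns (j + (k - j))"
            using j ns_mono sum.concat_blocks(2)[of "k - j" "\<lambda>i. ns (j + i)"] by auto
          then show "ns j \<le> n" using j ns by simp
        qed
        have "0 \<le> (\<Sum>l=ns (j - 1)..<ns j. ?o (Suc l) - ?o l)"
          using elim le assms(2) by (intro sum_nonneg) (force intro: padded_stat_mono less_imp_le)
        also have "\<dots> = V j \<omega>"
          using le assms(2) j by (simp add: sum_Suc_diff' V order_stat_eq_padded_stat)
        finally show "0 \<le> V j \<omega>" .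
      qed
    qed
  qed
  have X_bounds: "AE \<omega> in M. \<forall>j\<in>?J. ?std (X j \<omega>) \<in> {0..1}"
  proof (rule AE_finite_allI)
    fix j assume j: "j \<in> ?J"
    show "AE \<omega> in M. ?std (X j \<omega>) \<in> {0..1}"
      by (subst distributed_AE2[OF X_std[OF j]]) (auto simp: beta_density_def)
  qed simp

  define S where "S \<omega> = (\<Sum>j=1..k. V j \<omega> * ?std (X j \<omega>))" for \<omega>
  have rvS: "random_variable borel S"
    unfolding S_def
    by (intro borel_measurable_sum borel_measurable_times borel_measurable_divide borel_measurable_diff
        borel_measurable_const rvV rvX) auto
  have S_bounds: "AE \<omega> in M. S \<omega> \<in> {0..1}"
    using V_nonneg X_bounds
  proof eventually_elim
    case (elim \<omega>)
    have "S \<omega> \<le> (\<Sum>j=1..k. V j \<omega> * 1)"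
      unfolding S_def using elim by (intro sum_mono mult_left_mono) auto
    moreover have "0 \<le> S \<omega>"
      unfolding S_def using elim by (intro sum_nonneg mult_nonneg_nonneg) auto
    ultimately show ?case using sum_V[of \<omega>] by simp
  qed

  have moment: "(\<integral>\<^sup>+\<omega>. ennreal (S \<omega> ^ m) \<partial>M) = ennreal (pochhammer ?\<sigma> m / pochhammer (real n) m)" for m
  proof -
    let ?dX = "distr M ?PJ (\<lambda>\<omega>. \<lambda>j\<in>?J. X j \<omega>)" and ?dV = "distr M ?PJ (\<lambda>\<omega>. \<lambda>j\<in>?J. V j \<omega>)"
    let ?C = "fact m / pochhammer (real n) m"
    \<comment> \<open>The block formula demands nonnegative arguments everywhere, whereas the
      rescaled \<open>X j\<close> are nonnegative only almost surely; the absolute values repair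
      this without changing the integral.\<close>
    define f where "f = (\<lambda>(x, v). ennreal ((\<Sum>j=1..k. v j * \<bar>?std (x j)\<bar>) ^ m))"
    have f [measurable]: "f \<in> borel_measurable (?PJ \<Otimes>\<^sub>M ?PJ)"
      unfolding f_def by measurable
    \<comment> \<open>A product probability space wants a probability measure at every index;
      outside \<open>{1..k}\<close> the uniform law is a filler.\<close>
    define D where "D j = (if j \<in> ?J then distr M borel (X j) else unit_uniform)" for j
    have pD: "product_prob_space D"
      using prob_space_distr[OF rvX] by (intro product_prob_spaceI) (simp add: D_def prob_space_unit_uniform)
    interpret dV: prob_space ?dV by (rule prob_space_distr[OF rvVs])
    interpret D: product_prob_space D by (rule pD)
    have dX: "?dX = Pi\<^sub>M ?J D"
    proof -
      have "?dX = Pi\<^sub>M ?J (\<lambda>j. distr M borel (X j))"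
        using assms(3,14) rvX by (subst indep_vars_iff_distr_eq_PiM'[symmetric]) auto
      also have "\<dots> = Pi\<^sub>M ?J D" by (rule PiM_cong) (auto simp: D_def)
      finally show ?thesis .
    qed
    \<comment> \<open>The weights are integrated out with \<open>x\<close> fixed, which independence
      of \<open>X\<close> and \<open>V\<close> permits.\<close>
    have inner: "(\<integral>\<^sup>+v. f (x, v) \<partial>?dV) = ennreal ?C * ennreal ((\<Prod>j\<in>?J. rising_fps (r j) \<bar>?std (x j)\<bar>) $ m)" for x
    proof -
      have "(\<integral>\<^sup>+v. f (x, v) \<partial>?dV) = (\<integral>\<^sup>+\<omega>. f (x, \<lambda>j\<in>?J. V j \<omega>) \<partial>M)"
        unfolding f_def prod.case by (rule nn_integral_distr[OF rvVs]) measurable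
      also have "\<dots> = (\<integral>\<^sup>+\<omega>. ennreal ((\<Sum>j<k. (order_stat n (\<lambda>i. Y i \<omega>) (ns (Suc j)) - order_stat n (\<lambda>i. Y i \<omega>) (ns j))
              * \<bar>?std (x (Suc j))\<bar>) ^ m) \<partial>M)"
        unfolding f_def prod.case shift
        by (intro nn_integral_cong arg_cong[of _ _ ennreal] arg_cong2[of _ _ _ _ "(^)"] sum.cong refl) (simp add: V)
      also have "\<dots> = ennreal (?C * (\<Prod>j<k. rising_fps (real (ns (Suc j) - ns j)) \<bar>?std (x (Suc j))\<bar>) $ m)"
        by (rule nn_integral_weighted_blocks[where x = "\<lambda>j. \<bar>?std (x j)\<bar>",
              OF assms(2) ns ns_mono assms(11)[folded I] unif]) auto
      also have "(\<Prod>j<k. rising_fps (real (ns (Suc j) - ns j)) \<bar>?std (x (Suc j))\<bar>)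
          = (\<Prod>j\<in>?J. rising_fps (r j) \<bar>?std (x j)\<bar>)"
        by (simp add: prod.atLeast1_atMost_eq r)
      also have "ennreal (?C * (\<Prod>j\<in>?J. rising_fps (r j) \<bar>?std (x j)\<bar>) $ m)
          = ennreal ?C * ennreal ((\<Prod>j\<in>?J. rising_fps (r j) \<bar>?std (x j)\<bar>) $ m)"
        using assms(2) by (intro ennreal_mult' divide_nonneg_pos pochhammer_pos) auto
      finally show ?thesis .
    qed
    have "(\<integral>\<^sup>+\<omega>. ennreal (S \<omega> ^ m) \<partial>M) = (\<integral>\<^sup>+\<omega>. f (\<lambda>j\<in>?J. X j \<omega>, \<lambda>j\<in>?J. V j \<omega>) \<partial>M)"
    proof (rule nn_integral_cong_AE)
      show "AE \<omega> in M. ennreal (S \<omega> ^ m) = f (\<lambda>j\<in>?J. X j \<omega>, \<lambda>j\<in>?J. V j \<omega>)"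
        using X_bounds
      proof eventually_elim
        case (elim \<omega>)
        then have "S \<omega> = (\<Sum>j=1..k. V j \<omega> * \<bar>?std (X j \<omega>)\<bar>)"
          unfolding S_def by (intro sum.cong refl) (simp only: atLeastAtMost_iff abs_of_nonneg)
        then show ?case by (simp add: f_def)
      qed
    qed
    also have "\<dots> = (\<integral>\<^sup>+z. f z \<partial>distr M (?PJ \<Otimes>\<^sub>M ?PJ) (\<lambda>\<omega>. (\<lambda>j\<in>?J. X j \<omega>, \<lambda>j\<in>?J. V j \<omega>)))"
      using rvXs rvVs f by (subst nn_integral_distr) auto
    also have "\<dots> = (\<integral>\<^sup>+x. \<integral>\<^sup>+v. f (x, v) \<partial>?dV \<partial>?dX)"
      unfolding joint[symmetric] 
    proof (rule dV.nn_integral_fst[symmetric])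
      show "f \<in> borel_measurable (?dX \<Otimes>\<^sub>M ?dV)"
        using f measurable_cong_sets[OF sets_pair_measure_cong[OF sets_distr sets_distr] refl] by blast
    qed
    also have "\<dots> = ennreal ?C * (\<integral>\<^sup>+x. ennreal ((\<Prod>j\<in>?J. rising_fps (r j) \<bar>?std (x j)\<bar>) $ m) \<partial>?dX)"
      unfolding inner
    proof (rule nn_integral_cmult)
      have "(\<lambda>x. (\<Prod>j\<in>?J. rising_fps (r j) \<bar>?std (x j)\<bar>) $ m) \<in> borel_measurable ?PJ"
        unfolding rising_fps_def by (intro measurable_fps_prod_nth) simp
      then show "(\<lambda>x. ennreal ((\<Prod>j\<in>?J. rising_fps (r j) \<bar>?std (x j)\<bar>) $ m)) \<in> borel_measurable ?dX"
        by simp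
    qed
    also have "(\<integral>\<^sup>+x. ennreal ((\<Prod>j\<in>?J. rising_fps (r j) \<bar>?std (x j)\<bar>) $ m) \<partial>?dX)
        = ennreal ((\<Prod>j\<in>?J. rising_fps (s j) 1) $ m)"
      unfolding dX
    proof (rule D.nn_integral_fps_prod)
      fix j q assume j: "j \<in> ?J"
      have sr: "0 < s j" "s j < r j" using s[OF j] by auto
      show "(\<lambda>x. rising_fps (r j) \<bar>?std x\<bar> $ q) \<in> borel_measurable (D j)"
        using j by (simp add: D_def rising_fps_nth)
      show "0 \<le> rising_fps (r j) \<bar>?std x\<bar> $ q" for x
        using sr by (intro rising_fps_nonneg) auto
      show "0 \<le> rising_fps (s j) 1 $ q"
        using sr by (intro rising_fps_nonneg) auto
      have pos: "0 < pochhammer (r j) q" using sr by (intro pochhammer_pos) auto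
      have "(\<integral>\<^sup>+x. ennreal (rising_fps (r j) \<bar>?std x\<bar> $ q) \<partial>D j)
          = (\<integral>\<^sup>+\<omega>. ennreal (pochhammer (r j) q / fact q * \<bar>?std (X j \<omega>)\<bar> ^ q) \<partial>M)"
        using j rvX by (simp add: D_def rising_fps_nth nn_integral_distr)
      also have "\<dots> = (\<integral>\<^sup>+y. ennreal (beta_density 0 1 (s j) (r j - s j) y) *
          ennreal (pochhammer (r j) q / fact q * \<bar>y\<bar> ^ q) \<partial>lborel)"
        by (rule distributed_nn_integral[OF X_std[OF j], symmetric]) measurable
      also have "\<dots> = (\<integral>\<^sup>+y. ennreal (pochhammer (r j) q / fact q) *
          (ennreal (beta_density 0 1 (s j) (r j - s j) y) * ennreal (y ^ q)) \<partial>lborel)"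
      proof (rule nn_integral_cong)
        fix y :: real
        show "ennreal (beta_density 0 1 (s j) (r j - s j) y) * ennreal (pochhammer (r j) q / fact q * \<bar>y\<bar> ^ q)
          = ennreal (pochhammer (r j) q / fact q) * (ennreal (beta_density 0 1 (s j) (r j - s j) y) * ennreal (y ^ q))"
        \<comment> \<open>For \<open>y \<le> 0\<close> the density vanishes, so the absolute value
          may be dropped.\<close>
        proof (cases "0 < y")
          case True
          then have "ennreal (pochhammer (r j) q / fact q * \<bar>y\<bar> ^ q) = ennreal (pochhammer (r j) q / fact q) * ennreal (y ^ q)"
            using pos by (subst ennreal_mult[symmetric]) auto
          then show ?thesis by (simp only: mult.left_commute)
        qed (simp add: beta_density_def)
      qed
      also have "\<dots> = ennreal (pochhammer (r j) q / fact q) * ennreal (pochhammer (s j) q / pochhammer (r j) q)"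
        using beta_density_moment[of "s j" "r j - s j" q] sr by (subst nn_integral_cmult) auto
      \<comment> \<open>Here \<open>pochhammer (r j) q\<close> cancels, as
        \<open>s j + (r j - s j) = r j\<close>. What remains is the same series with exponent
        \<open>s j\<close> at the point 1, so the factors for different \<open>j\<close> share their
        base and their exponents add.\<close>
      also have "\<dots> = ennreal (rising_fps (s j) 1 $ q)"
        using pos by (simp add: rising_fps_nth ennreal_mult'[symmetric])
      finally show "(\<integral>\<^sup>+x. ennreal (rising_fps (r j) \<bar>?std x\<bar> $ q) \<partial>D j) = \<dots>" .
    qed simp
    also have "(\<Prod>j\<in>?J. rising_fps (s j) 1) $ m = pochhammer ?\<sigma> m / fact m"
      by (simp add: rising_fps_sum[symmetric] rising_fps_nth)
    also have "ennreal ?C * ennreal (pochhammer ?\<sigma> m / fact m) = ennreal (pochhammer ?\<sigma> m / pochhammer (real n) m)"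
    proof -
      have "0 < pochhammer (real n) m" using assms(2) by (intro pochhammer_pos) simp
      then show ?thesis by (subst ennreal_mult'[symmetric]) simp_all
    qed
    finally show ?thesis .
  qed

  have "distributed M lborel S (\<lambda>x. ennreal (beta_density 0 1 ?\<sigma> (real n - ?\<sigma>) x))"
    using \<sigma> rvS S_bounds moment by (intro distributed_beta_if_moments) auto
  then have "distributed M lborel (\<lambda>\<omega>. a + (b - a) * S \<omega>) (\<lambda>x. ennreal (beta_density a b ?\<sigma> (real n - ?\<sigma>) x))"
    using ab \<sigma> by (intro distributed_beta_unstandardize) auto
  also have "(\<lambda>\<omega>. a + (b - a) * S \<omega>) = (\<lambda>\<omega>. \<Sum>j=1..k. V j \<omega> * X j \<omega>)"
  proof
    fix \<omega>
    \<comment> \<open>Each \<open>X j\<close> is written as \<open>a\<close> plus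
      \<open>b - a\<close> times its rescaled value; the weights sum to 1, so the terms with
      \<open>a\<close> add up to \<open>a\<close>.\<close>
    have "(\<Sum>j=1..k. V j \<omega> * X j \<omega>) = (\<Sum>j=1..k. V j \<omega> * a + (b - a) * (V j \<omega> * ?std (X j \<omega>)))"
      using ab by (intro sum.cong refl) (simp add: field_simps)
    also have "\<dots> = a + (b - a) * S \<omega>"
      unfolding S_def sum.distrib sum_distrib_right[symmetric] sum_distrib_left[symmetric] sum_V by simp
    finally show "a + (b - a) * S \<omega> = (\<Sum>j=1..k. V j \<omega> * X j \<omega>)" ..
  qed
  finally show ?thesis unfolding sum_r .
qed

end
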